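(* Let $d\geq 3$ and let $\mathcal{P}=\{\mathbf{B}^d[\mathbf{c}_i,1]\mid 1\leq i\leq n\}$ be an arbitrary LS-packing of $n>1$ unit balls in $\mathbb{E}^d$. Then $$c(\mathcal{P})\leq \left\lfloor dn-\left(d^{-\frac{d-3}{2}}\hat{\delta}_d^{-\frac{d-1}{d}}\right)n^{\frac{d-1}{d}}\right\rfloor .$$
   Context: $\mathbf{B}^d[\mathbf{p},r]$ denotes the closed Euclidean ball of radius $r$ centered at $\mathbf{p}$ in $\mathbb{E}^d$, and $\omega_d=\mathrm{vol}_d(\mathbf{B}^d[\mathbf{o},1])$. A family of unit balls is a packing if their interiors are pairwise disjoint (centers at distance $\geq 2$). A packing of balls is totally separable (a TS-packing) if any two of its balls can be separated by a hyperplane that is disjoint from the interior of every ball of the packing. A packing $\mathcal{P}$ of balls is locally separable (an LS-packing) if each ball of $\mathcal{P}$ together with the balls of $\mathcal{P}$ tangent to it form a TS-packing. The contact number $c(\mathcal{P})$ of a finite packing is the number of unordered pairs of balls of $\mathcal{P}$ that are tangent to each other. For a (finite or infinite) unit ball packing $\{\mathbf{B}^d[\mathbf{c}_i,1]\mid i\in I\}$, the Voronoi cell of the $i$-th ball is $\mathbf{V}_i=\{\mathbf{x}\in\mathbb{E}^d\mid \|\mathbf{x}-\mathbf{c}_i\|\leq\|\mathbf{x}-\mathbf{c}_j\| \text{ for all } j\in I, j\neq i\}$. Define $$\hat{\delta}_d=\sup_{\mathcal{P}'}\ \sup_{i\in I}\frac{\omega_d}{\mathrm{vol}_d\left(\mathbf{V}_i\cap\mathbf{B}^d[\mathbf{c}_i,\sqrt{d}]\right)},$$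 where $\mathcal{P}'=\{\mathbf{B}^d[\mathbf{c}_i,1]\mid i\in I\}$ runs over all (finite or infinite) packings of unit balls in $\mathbb{E}^d$. *)

theory Defs
  imports "HOL-Analysis.Analysis"
begin

definition unit_ball_packing :: "'a::euclidean_space set \<Rightarrow> bool" where
  "unit_ball_packing C \<longleftrightarrow> (\<forall>p\<in>C. \<forall>q\<in>C. p \<noteq> q \<longrightarrow> 2 \<le> dist p q)"

definition fin_unit_ball_packing :: "nat \<Rightarrow> (nat \<Rightarrow> 'a::euclidean_space) \<Rightarrow> bool" where
  "fin_unit_ball_packing n c \<longleftrightarrow> (\<forall>i<n. \<forall>j<n. i \<noteq> j \<longrightarrow> 2 \<le> dist (c i) (c j))"

definition totally_separable :: "'a::euclidean_space set \<Rightarrow> bool" where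
  "totally_separable C \<longleftrightarrow>
     (\<forall>p\<in>C. \<forall>q\<in>C. p \<noteq> q \<longrightarrow>
        (\<exists>a b. a \<noteq> 0 \<and>
               (\<forall>x\<in>cball p 1. a \<bullet> x \<le> b) \<and>
               (\<forall>x\<in>cball q 1. b \<le> a \<bullet> x) \<and>
               (\<forall>k\<in>C. {x. a \<bullet> x = b} \<inter> ball k 1 = {})))"

definition locally_separable :: "nat \<Rightarrow> (nat \<Rightarrow> 'a::euclidean_space) \<Rightarrow> bool" where
  "locally_separable n c \<longleftrightarrow>
     (\<forall>i<n. totally_separable ({c i} \<union> {c j |j. j < n \<and> dist (c i) (c j) = 2}))"

definition contact_number :: "nat \<Rightarrow> (nat \<Rightarrow> 'a::euclidean_space) \<Rightarrow> nat" where
  "contact_number n c = card {(i, j). i < j \<and> j < n \<and> dist (c i) (c j) = 2}"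

definition voronoi_cell :: "'a::euclidean_space set \<Rightarrow> 'a \<Rightarrow> 'a set" where
  "voronoi_cell C p = {x. \<forall>q\<in>C. q \<noteq> p \<longrightarrow> dist x p \<le> dist x q}"

definition omega :: "'a::euclidean_space itself \<Rightarrow> real" where
  "omega _ = measure lebesgue (cball (0::'a) 1)"

definition delta_hat :: "'a::euclidean_space itself \<Rightarrow> real" where
  "delta_hat T = Sup {omega T / measure lebesgue (voronoi_cell C p \<inter> cball p (sqrt (real DIM('a))))
                      | (C :: 'a set) p. unit_ball_packing C \<and> p \<in> C}"

end

(* By local separability the directions from a center to its tangent neighbours are unit vectors
   with pairwise non-positive inner products.  Each such
   direction u owns the cone of points x with <u,x> >= |x| / sqrt d that are closer to u than to any
   other direction, and this cone takes up at least 1/(2d) of space, as it does for the directions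
   +-e_1, ..., +-e_d: reflections rotate the other directions, one at a time, into such a cross
   without increasing the measure of the cone of u.  The neighbour in direction u covers the part
   of the sphere of radius sqrt d in the cone of u, so a ball with k neighbours contributes at most
   the fraction 1 - k/(2d) of that sphere to the boundary of the union A of the balls of radius
   sqrt d.  On the other hand A contains the truncated Voronoi cells, so its volume is at least
   n omega_d / delta_hat_d, and the Brunn-Minkowski inequality bounds its surface from below. *)

theory Submission
  imports Defs
begin

section \<open>Reflections preserve Lebesgue measure\<close>

text \<open>Surface area is replaced by finite differences. For radii sqrt d < R < \<beta>, the
  volume that the union of balls gains between R and \<beta> is bounded above by the uncovered parts
  of the shells, and below by the Brunn-Minkowski inequality for the union of the R-balls and a ball
  of radius \<beta> - R. Dividing by \<beta> - R and letting the radii tend to sqrt d yields the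
  estimate.

  Origin of the radius sqrt d: the cell of e_1 in the cross is the cone where every other |x_i| is
  below x_1, and it reaches out to the angle with cosine 1 / sqrt d. A point of norm t at that angle
  to u has squared distance t^2 - 4t / sqrt d + 4 from the neighbouring center 2u, which equals t^2
  exactly at t = sqrt d.

  Summing 1 - k/(2d) over the balls counts every contact twice and gives n - c/d. Multiplying by d
  and dividing by the factor (sqrt d)^(d-1) of the sphere produces the coefficient d * d^(-(d-1)/2)
  = d^(-(d-3)/2).\<close>

definition reflection :: "'a::euclidean_space \<Rightarrow> 'a \<Rightarrow> 'a" where
  "reflection w x = x - (2 * (w \<bullet> x) / (w \<bullet> w)) *\<^sub>R w"

lemma reflection_reflection [simp]: "reflection w (reflection w x) = x"
  by (cases "w = 0") (simp_all add: reflection_def inner_diff_right algebra_simps)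

lemma linear_reflection: "linear (reflection w)"
  unfolding reflection_def
  by (intro linearI) (simp_all add: inner_add_right algebra_simps add_divide_distrib)

lemma reflection_diff: "reflection w (x - y) = reflection w x - reflection w y"
  by (rule linear_diff [OF linear_reflection])

lemma norm_reflection [simp]: "norm (reflection w x) = norm x"
proof (cases "w = 0")
  case False
  then have "reflection w x \<bullet> reflection w x = x \<bullet> x"
    by (simp add: reflection_def inner_diff_left inner_diff_right inner_commute field_simps)
  then show ?thesis
    by (simp add: norm_eq_sqrt_inner)
qed (simp add: reflection_def)

lemma dist_reflection [simp]: "dist (reflection w x) (reflection w y) = dist x y"
  by (metis dist_norm norm_reflection reflection_diff)

lemma inner_reflection: "v \<bullet> reflection w x = v \<bullet> x - 2 * (w \<bullet> x) / (w \<bullet> w) * (v \<bullet> w)"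
  by (simp add: reflection_def inner_diff_right)

lemma image_reflection: "reflection w ` S = reflection w -` S"
  by (force simp: image_iff)

lemma image_reflection_ball: "reflection w ` ball x r = ball (reflection w x) r"
  unfolding image_reflection by (auto simp: ball_def) (metis dist_reflection reflection_reflection)+

lemma borel_measurable_reflection: "reflection w \<in> borel_measurable borel"
  by (simp add: borel_measurable_continuous_onI linear_continuous_on linear_linear linear_reflection)

lemma reflection_image_borel: "S \<in> sets borel \<Longrightarrow> reflection w ` S \<in> sets borel"
  unfolding image_reflection using measurable_sets [OF borel_measurable_reflection, of S w] by simp

lemma bounded_reflection_image: "bounded X \<Longrightarrow> bounded (reflection w ` X)"
  by (auto simp: bounded_iff)

text \<open>Reflections map balls to balls of the same radius, and disjoint balls from a Vitali
  covering exhaust \<open>U\<close> up to a null set, whose image is again null by linearity. An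
  inequality is enough, because a reflection is its own inverse.\<close>

lemma open_reflection_image_lmeasure_le:
  fixes U :: "'a::euclidean_space set"
  assumes "open U" "bounded U"
  shows "measure lebesgue (reflection w ` U) \<le> measure lebesgue U"
proof -
  define K where "K = {(x::'a, r::real). ball x r \<subseteq> U}"
  have "\<exists>i. i \<in> K \<and> x \<in> ball (fst i) (snd i) \<and> snd i < d" if "x \<in> U" "0 < d" for x d
  proof -
    obtain e where "e > 0" "ball x e \<subseteq> U"
      using \<open>open U\<close> \<open>x \<in> U\<close> openE by blast
    then have "ball x (min e (d/2)) \<subseteq> U" by auto
    then show ?thesis
      using \<open>0 < d\<close> \<open>e > 0\<close> by (intro exI[of _ "(x, min e (d/2))"]) (auto simp: K_def)
  qed
  from Vitali_covering_theorem_balls [of U K fst snd, OF this]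
  obtain C where C: "countable C" "C \<subseteq> K"
     and pw: "pairwise (\<lambda>i j. disjnt (ball (fst i) (snd i)) (ball (fst j) (snd j))) C"
     and neg: "negligible (U - (\<Union>i\<in>C. ball (fst i) (snd i)))"
    by blast
  define B where "B = (\<Union>i\<in>C. ball (fst i) (snd i))"
  have "B \<subseteq> U"
    using C by (fastforce simp: B_def K_def subset_iff)
  have lmU: "U \<in> lmeasurable" by (simp add: assms lmeasurable_open)
  have "open B" by (auto simp: B_def)
  have rB: "reflection w ` B = (\<Union>i\<in>C. ball (reflection w (fst i)) (snd i))"
    by (simp add: B_def image_UN image_reflection_ball)
  have em: "emeasure lborel (reflection w ` B) = emeasure lborel B"
  proof -
    have "emeasure lborel (reflection w ` B) = (\<integral>\<^sup>+i. emeasure lborel (ball (reflection w (fst i)) (snd i)) \<partial>count_space C)"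
      unfolding rB
    proof (rule emeasure_UN_countable)
      show "disjoint_family_on (\<lambda>i. ball (reflection w (fst i)) (snd i)) C"
        unfolding disjoint_family_on_def image_reflection_ball [symmetric]
      proof (intro ballI impI)
        fix i j assume "i \<in> C" "j \<in> C" "i \<noteq> j"
        then have "ball (fst i) (snd i) \<inter> ball (fst j) (snd j) = {}"
          using pw unfolding pairwise_def disjnt_def by blast
        then show "reflection w ` ball (fst i) (snd i) \<inter> reflection w ` ball (fst j) (snd j) = {}"
          unfolding image_reflection by blast
      qed
    qed (use C in auto)
    also have "\<dots> = (\<integral>\<^sup>+i. emeasure lborel (ball (fst i) (snd i)) \<partial>count_space C)"
    proof (rule nn_integral_cong)
      fix i assume "i \<in> space (count_space C)"
      show "emeasure lborel (ball (reflection w (fst i)) (snd i)) = emeasure lborel (ball (fst i) (snd i))"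
        \<comment> \<open>\<open>K\<close> also admits negative radii, for which both balls are
          empty.\<close>
        by (cases "snd i \<ge> 0") (simp_all add: emeasure_ball ball_empty)
    qed
    also have "\<dots> = emeasure lborel B"
      unfolding B_def
    proof (rule emeasure_UN_countable [symmetric])
      show "disjoint_family_on (\<lambda>i. ball (fst i) (snd i)) C"
        using pw unfolding disjoint_family_on_def pairwise_def disjnt_def by blast
    qed (use C in auto)
    finally show ?thesis .
  qed
  have "negligible (reflection w ` (U - B))"
    using neg unfolding B_def
    by (intro negligible_differentiable_image_negligible)
       (auto simp: linear_imp_differentiable_on linear_reflection)
  moreover have "reflection w ` U = reflection w ` B \<union> reflection w ` (U - B)"
    using \<open>B \<subseteq> U\<close> by blast
  moreover have oB: "open (reflection w ` B)"
    unfolding rB by auto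
  moreover have "reflection w ` B \<in> lmeasurable"
    by (intro lmeasurable_open oB bounded_reflection_image bounded_subset [OF \<open>bounded U\<close> \<open>B \<subseteq> U\<close>])
  ultimately have "measure lebesgue (reflection w ` U) = measure lebesgue (reflection w ` B)"
    by (simp add: measure_Un3 negligible_imp_measurable negligible_imp_measure0 negligible_Int)
  also have "\<dots> = measure lebesgue B"
    using em oB \<open>open B\<close> by (simp add: measure_def)
  also have "\<dots> \<le> measure lebesgue U"
    by (intro measure_mono_fmeasurable) (use \<open>B \<subseteq> U\<close> lmU \<open>open B\<close> in auto)
  finally show ?thesis .
qed

lemma lmeasurable_bounded_borel: "S \<in> sets borel \<Longrightarrow> bounded S \<Longrightarrow> S \<in> lmeasurable"
  for S :: "'a::euclidean_space set"
  by (simp add: bounded_set_imp_lmeasurable)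

text \<open>The inequality for open sets passes to bounded Borel sets by outer approximation;
  applied to the image, it gives the converse.\<close>

lemma measure_reflection_image:
  fixes S :: "'a::euclidean_space set"
  assumes "S \<in> sets borel" "bounded S"
  shows "measure lebesgue (reflection w ` S) = measure lebesgue S"
proof -
  have le: "measure lebesgue (reflection w ` S) \<le> measure lebesgue S" 
    if S: "S \<in> sets borel" "bounded S" for S :: "'a set"
  proof (rule field_le_epsilon)
    fix e :: real assume "e > 0"
    obtain r where r: "S \<subseteq> ball 0 r"
      using \<open>bounded S\<close> bounded_subset_ballD by blast
    obtain T where T: "open T" "S \<subseteq> T" "(T - S) \<in> lmeasurable" "emeasure lebesgue (T - S) < ennreal e"
      using sets_lebesgue_outer_open [of S e] S \<open>e > 0\<close> by auto
    define U where "U = T \<inter> ball 0 r"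
    have U: "open U" "bounded U" "S \<subseteq> U" "U \<subseteq> T"
      using T r by (auto simp: U_def)
    have lm: "S \<in> lmeasurable" "U \<in> lmeasurable"
      using S U by (auto intro: lmeasurable_bounded_borel)
    have lmr: "reflection w ` S \<in> lmeasurable" "reflection w ` U \<in> lmeasurable"
      using S U by (auto intro!: lmeasurable_bounded_borel reflection_image_borel bounded_reflection_image)
    have "measure lebesgue (reflection w ` S) \<le> measure lebesgue (reflection w ` U)"
      by (intro measure_mono_fmeasurable image_mono fmeasurableD lmr U)
    also have "\<dots> \<le> measure lebesgue U"
      by (rule open_reflection_image_lmeasure_le [OF U(1,2)])
    also have "\<dots> = measure lebesgue S + measure lebesgue (U - S)"
      using measurable_measure_Diff [OF lm(2) fmeasurableD [OF lm(1)] U(3)] by linarith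
    also have "measure lebesgue (U - S) \<le> measure lebesgue (T - S)"
      by (intro measure_mono_fmeasurable Diff_mono fmeasurableD fmeasurable.Diff T lm U subset_refl)
    also have "measure lebesgue (T - S) \<le> e"
      using T(4) unfolding emeasure_eq_measure2 [OF T(3)] by (simp add: ennreal_less_iff)
    finally show "measure lebesgue (reflection w ` S) \<le> measure lebesgue S + e" by simp
  qed
  have "measure lebesgue (reflection w ` reflection w ` S) \<le> measure lebesgue (reflection w ` S)"
    by (intro le reflection_image_borel bounded_reflection_image assms)
  then show ?thesis
    using le [OF assms] by (simp add: image_image)
qed

section \<open>Cells of non-acute systems of unit vectors\<close>

text \<open>An intermediate stage between the cell of a system of directions and the cell of the
  cross: vectors of \<open>E\<close> already act as antipodal pairs and cut out slabs, while those
  of \<open>Z\<close> still contribute one half-space each.\<close>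

definition frame_cell :: "'a::euclidean_space set \<Rightarrow> 'a \<Rightarrow> 'a set \<Rightarrow> 'a set \<Rightarrow> 'a set" where
  "frame_cell X u E Z =
     {x \<in> X. 0 < u \<bullet> x \<and> (\<forall>e\<in>E. \<bar>e \<bullet> x\<bar> < u \<bullet> x) \<and> (\<forall>z\<in>Z. z \<bullet> x < u \<bullet> x)}"

lemma frame_cell_borel:
  assumes "X \<in> sets borel" "finite E" "finite Z"
  shows "frame_cell X u E Z \<in> sets borel"
proof -
  have "frame_cell X u E Z = X \<inter> {x. 0 < u \<bullet> x} \<inter> (\<Inter>e\<in>E. {x. \<bar>e \<bullet> x\<bar> < u \<bullet> x})
          \<inter> (\<Inter>z\<in>Z. {x. z \<bullet> x < u \<bullet> x})"
    by (auto simp: frame_cell_def)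
  moreover have "open ({x. 0 < u \<bullet> x} \<inter> (\<Inter>e\<in>E. {x. \<bar>e \<bullet> x\<bar> < u \<bullet> x}) \<inter> (\<Inter>z\<in>Z. {x. z \<bullet> x < u \<bullet> x}))"
  proof (intro open_Int open_INT ballI)
    show "finite E" "finite Z" by fact+
  qed (intro open_Collect_less continuous_intros)+
  ultimately show ?thesis
    using assms(1) sets.Int [OF assms(1) borel_open] by (simp add: Int_assoc)
qed

lemma frame_cell_subset: "frame_cell X u E Z \<subseteq> X"
  by (auto simp: frame_cell_def)

lemma frame_cell_lmeasurable:
  assumes "X \<in> sets borel" "bounded X" "finite E" "finite Z"
  shows "frame_cell X u E Z \<in> lmeasurable"
  using assms by (intro lmeasurable_bounded_borel frame_cell_borel bounded_subset [OF _ frame_cell_subset])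

text \<open>The reflection exchanging \<^term>\<open>w\<close> and \<^term>\<open>c *\<^sub>R w - s *\<^sub>R a\<close> maps the points
  lost by the rotation into the points gained: it moves them in a direction that only relaxes
  the constraints of \<^term>\<open>Z\<close>, and the slab constraint for \<^term>\<open>a\<close> survives because
  the points lost have a positive \<^term>\<open>w\<close>-coordinate.\<close>

lemma measure_frame_cell_rotate:
  fixes X :: "'a::euclidean_space set"
  assumes X: "X \<in> sets borel" "bounded X"
    and inv: "\<And>y x. y \<bullet> u = 0 \<Longrightarrow> x \<in> X \<Longrightarrow> reflection y x \<in> X"
    and aw: "a \<bullet> a = 1" "w \<bullet> w = 1" "a \<bullet> w = 0" "a \<bullet> u = 0" "w \<bullet> u = 0"
    and sc: "0 \<le> s" "0 < c" "s\<^sup>2 + c\<^sup>2 = 1"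
    and E: "finite E" "a \<in> E" "\<And>e. e \<in> E \<Longrightarrow> e \<noteq> a \<Longrightarrow> e \<bullet> a = 0 \<and> e \<bullet> w = 0"
    and Z: "finite Z" "\<And>z. z \<in> Z \<Longrightarrow> z \<bullet> a \<le> 0 \<and> z \<bullet> w \<le> 0"
  shows "measure lebesgue (frame_cell X u E (insert w Z))
       \<le> measure lebesgue (frame_cell X u E (insert (c *\<^sub>R w - s *\<^sub>R a) Z))"
proof (cases "s = 0")
  case True
  with sc have "c = 1"
    by (simp add: power2_eq_1_iff)
  with True show ?thesis by simp
next
  case False
  \<comment> \<open>In the application \<open>v\<close> is one of the given directions, with
    \<open>v \<bullet> a = - s\<close>, and \<open>w\<close> is its normalized projection to the
    complement of \<open>a\<close>.\<close>
  define v where "v = c *\<^sub>R w - s *\<^sub>R a"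
  define y where "y = w - v"
  define A where "A = frame_cell X u E (insert w Z)"
  define B where "B = frame_cell X u E (insert v Z)"
  have "s\<^sup>2 > 0" "c\<^sup>2 > 0" using False sc by auto
  then have "c\<^sup>2 < 1" "s\<^sup>2 < 1" using sc(3) by linarith+
  then have c1: "c < 1" and s1: "s < 1"
    using power2_less_imp_less [of c 1] power2_less_imp_less [of s 1] by simp_all
  have s2: "s * s = (1 - c) * (1 + c)"
    using sc by (simp add: algebra_simps power2_eq_square)
  have wa: "w \<bullet> a = 0" using aw by (simp add: inner_commute)
  have yw: "w \<bullet> y = 1 - c" and yv: "v \<bullet> y = c - 1" and ya: "a \<bullet> y = s" and yu: "y \<bullet> u = 0"
    using aw wa sc(3) by (simp_all add: y_def v_def inner_diff_left inner_diff_right power2_eq_square)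
  have yy: "y \<bullet> y = 2 * (1 - c)"
    using yw yv by (simp add: y_def inner_diff_left)
  have sub: "reflection y ` (A - B) \<subseteq> B - A"
  proof clarify
    fix x assume x: "x \<in> A" "x \<notin> B"
    define h p q where "h = u \<bullet> x" and "p = a \<bullet> x" and "q = w \<bullet> x"
    have xX: "x \<in> X" and h: "h > 0" and xE: "\<And>e. e \<in> E \<Longrightarrow> \<bar>e \<bullet> x\<bar> < h" 
      and xZ: "\<And>z. z \<in> Z \<Longrightarrow> z \<bullet> x < h" and qh: "q < h"
      using x by (auto simp: A_def frame_cell_def h_def q_def)
    have vx: "v \<bullet> x = c * q - s * p"
      by (simp add: v_def p_def q_def inner_diff_left)
    have vh: "h \<le> v \<bullet> x"
      using x(2) xX h xE xZ by (auto simp: B_def frame_cell_def h_def)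
    have p: "\<bar>p\<bar> < h" using xE E by (auto simp: p_def)
    define k where "k = 2 * (y \<bullet> x) / (y \<bullet> y)"
    have yx: "y \<bullet> x = q - v \<bullet> x" by (simp add: y_def inner_diff_left q_def)
    have "k = (q - v \<bullet> x) / (1 - c)"
      unfolding k_def yy yx by (rule mult_divide_mult_cancel_left) simp
    then have k: "k * (1 - c) = q - v \<bullet> x"
      using c1 by simp
    have "k < 0"
      using c1 qh vh by (simp add: k_def yy yx divide_less_0_iff)
    have refl: "z \<bullet> reflection y x = z \<bullet> x - k * (z \<bullet> y)" for z
      by (simp add: inner_reflection k_def)
    have ru: "u \<bullet> reflection y x = h"
      using yu by (simp add: refl h_def inner_commute)
    have rw: "w \<bullet> reflection y x = v \<bullet> x"
      using k by (simp add: refl yw q_def)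
    have rv: "v \<bullet> reflection y x = q"
      using k by (simp add: refl yv algebra_simps)
    \<comment> \<open>Only \<open>k * (1 - c)\<close> is known, so the identity is proved after
      multiplication by \<open>1 - c\<close>; the factorization \<open>s2\<close> lets this factor
      cancel.\<close>
    have "k * s * (1 - c) = (s * q + (1 + c) * p) * (1 - c)"
    proof -
      have "k * s * (1 - c) = s * (q - v \<bullet> x)"
        unfolding k [symmetric] by simp
      also have "\<dots> = s * (1 - c) * q + s * s * p"
        by (simp add: vx algebra_simps)
      also have "\<dots> = (s * q + (1 + c) * p) * (1 - c)"
        by (simp add: s2 algebra_simps)
      finally show ?thesis .
    qed
    then have ks: "k * s = s * q + (1 + c) * p"
      using c1 by simp
    then have ra: "a \<bullet> reflection y x = - c * p - s * q"
      by (simp add: refl ya p_def [symmetric] algebra_simps)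
    \<comment> \<open>The mirror image has a larger \<open>a\<close>-coordinate than
      \<open>x\<close>, so the lower bound of the slab is inherited and only the upper one needs an
      argument.\<close>
    have "k * s < 0" using \<open>k < 0\<close> False sc(1) by (simp add: mult_neg_pos)
    then have lo: "- h < a \<bullet> reflection y x"
      using p by (simp add: refl ya p_def [symmetric])
    have hi: "a \<bullet> reflection y x < h"
    proof -
      have "s * (- h) \<le> s * p" 
        using p sc(1) by (intro mult_left_mono) auto
      moreover have "s * h < h" using s1 h by simp
      ultimately have "0 < c * q" using vh vx by linarith
      then have "0 < q" using sc(2) by (simp add: zero_less_mult_iff)
      then have "0 \<le> s * q" using sc(1) by simp
      moreover have "c * (- p) < c * h" using p sc(2) by (intro mult_strict_left_mono) auto
      moreover have "c * h < h" using c1 h by simp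
      ultimately show ?thesis using ra by simp
    qed
    have rE: "\<bar>e \<bullet> reflection y x\<bar> < h" if "e \<in> E" for e
    proof (cases "e = a")
      case False
      then have "e \<bullet> y = 0"
        using E(3) [OF that] by (simp add: y_def v_def inner_diff_right)
      then show ?thesis using xE [OF that] by (simp add: refl)
    qed (use lo hi in auto)
    have rZ: "z \<bullet> reflection y x < h" if "z \<in> Z" for z
    proof -
      have "y = (1 - c) *\<^sub>R w + s *\<^sub>R a"
        by (simp add: y_def v_def algebra_simps)
      then have "z \<bullet> y = (1 - c) * (z \<bullet> w) + s * (z \<bullet> a)"
        by (simp add: inner_add_right)
      also have "\<dots> \<le> 0"
        using Z(2) [OF that] c1 sc(1)
        by (intro add_nonpos_nonpos mult_nonneg_nonpos) auto
      finally have "0 \<le> k * (z \<bullet> y)" using \<open>k < 0\<close> by (simp add: mult_nonpos_nonpos)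
      then show ?thesis using xZ [OF that] by (simp add: refl)
    qed
    have "reflection y x \<in> X" using inv yu xX by blast
    then show "reflection y x \<in> B - A"
      using h qh vh rE rZ by (auto simp: A_def B_def frame_cell_def ru rw rv)
  qed
  have bA: "A \<in> sets borel" "B \<in> sets borel"
    unfolding A_def B_def using X E Z by (intro frame_cell_borel; simp)+
  have bdA: "bounded A" "bounded B"
    unfolding A_def B_def by (intro bounded_subset [OF X(2) frame_cell_subset])+
  have bD: "A - B \<in> sets borel" "B - A \<in> sets borel" "bounded (A - B)" "bounded (B - A)"
    using bA bdA bounded_subset [OF _ Diff_subset] by auto
  have lm: "A \<in> lmeasurable" "B \<in> lmeasurable" "A - B \<in> lmeasurable" "B - A \<in> lmeasurable"
    using bA bdA bD by (auto intro!: lmeasurable_bounded_borel)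
  have AB: "A \<inter> B \<in> lmeasurable"
    using lm by (intro fmeasurable.Int)
  have "measure lebesgue (A - B) = measure lebesgue (reflection y ` (A - B))"
    by (intro measure_reflection_image [symmetric] bD)
  also have "\<dots> \<le> measure lebesgue (B - A)"
    by (rule measure_mono_fmeasurable [OF sub fmeasurableD [OF lmeasurable_bounded_borel] lm(4)])
       (intro reflection_image_borel bounded_reflection_image bD)+
  finally have "measure lebesgue (A - B) \<le> measure lebesgue (B - A)" .
  moreover have "measure lebesgue (A - B) = measure lebesgue A - measure lebesgue (A \<inter> B)"
    using measurable_measure_Diff [OF lm(1) fmeasurableD [OF AB]] by (simp add: Diff_Int)
  moreover have "measure lebesgue (B - A) = measure lebesgue B - measure lebesgue (A \<inter> B)"
    using measurable_measure_Diff [OF lm(2) fmeasurableD [OF AB]] by (simp add: Diff_Int)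
  ultimately show ?thesis
    unfolding A_def B_def v_def by linarith
qed

section \<open>Orthonormal frames and the reduction of a non-acute system to a cross\<close>

definition orthonormal_to :: "'a::euclidean_space \<Rightarrow> 'a set \<Rightarrow> bool" where
  "orthonormal_to u E \<longleftrightarrow> finite E \<and> (\<forall>e\<in>E. e \<bullet> e = 1 \<and> e \<bullet> u = 0)
     \<and> (\<forall>e\<in>E. \<forall>f\<in>E. e \<noteq> f \<longrightarrow> e \<bullet> f = 0)"

definition complete_frame :: "'a::euclidean_space set \<Rightarrow> bool" where
  "complete_frame B \<longleftrightarrow> (\<forall>x. (\<forall>b\<in>B. b \<bullet> x = 0) \<longrightarrow> x = 0)"

lemma orthonormal_to_extend:
  fixes u :: "'a::euclidean_space"
  assumes "orthonormal_to u E" "u \<bullet> u = 1"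
  obtains B where "E \<subseteq> B" "orthonormal_to u B" "complete_frame (insert u B)"
proof -
  have E: "finite E" "\<And>e. e \<in> E \<Longrightarrow> e \<bullet> e = 1" "\<And>e. e \<in> E \<Longrightarrow> e \<bullet> u = 0" 
      "\<And>e f. e \<in> E \<Longrightarrow> f \<in> E \<Longrightarrow> e \<noteq> f \<Longrightarrow> e \<bullet> f = 0"
    using assms(1) by (auto simp: orthonormal_to_def)
  have "pairwise orthogonal (insert u E)"
    using E by (auto simp: pairwise_insert pairwise_def orthogonal_def inner_commute)
  then obtain U where U: "U \<inter> insert 0 (insert u E) = {}" "pairwise orthogonal (insert u E \<union> U)"
      and sp: "span (insert u E \<union> U) = span (insert u E \<union> UNIV)"
    by (rule orthogonal_extension_strong)
  have ort: "x \<bullet> y = 0" if "x \<in> U" "y \<in> insert u E \<union> U" "x \<noteq> y" for x y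
    using U(2) that by (auto simp: pairwise_def orthogonal_def)
  have U0: "x \<noteq> 0" "x \<notin> insert u E" if "x \<in> U" for x using U(1) that by auto
  have "finite U"
    using U(2) by (metis finite_Un pairwise_orthogonal_imp_finite)
  show ?thesis
  proof
    show "E \<subseteq> E \<union> sgn ` U" by simp
    have "sgn x \<bullet> y = 0" if "x \<in> U" "y \<in> insert u E" for x y
      using ort [of x y] U0 [of x] that by (auto simp: sgn_div_norm)
    moreover have "sgn x \<bullet> sgn y = 0" if "x \<in> U" "y \<in> U" "sgn x \<noteq> sgn y" for x y
      using ort [of x y] that by (auto simp: sgn_div_norm)
    moreover have "sgn x \<bullet> sgn x = 1" if "x \<in> U" for x
      using U0 [OF that] by (metis norm_eq_1 norm_sgn)
    ultimately show "orthonormal_to u (E \<union> sgn ` U)"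
      using E \<open>finite U\<close> by (auto simp: orthonormal_to_def inner_commute)
    show "complete_frame (insert u (E \<union> sgn ` U))"
      unfolding complete_frame_def
    proof (intro allI impI)
      fix x assume x: "\<forall>b\<in>insert u (E \<union> sgn ` U). b \<bullet> x = 0"
      have "orthogonal x b" if b: "b \<in> insert u E \<union> U" for b
      proof (cases "b \<in> U")
        case True
        then have "sgn b \<bullet> x = 0" using x by blast
        then show ?thesis
          using U0 [OF True] by (simp add: sgn_div_norm orthogonal_def inner_commute)
      qed (use b x in \<open>auto simp: orthogonal_def inner_commute\<close>)
      then have "orthogonal x x"
        using orthogonal_to_span [of x "insert u E \<union> U" x] sp by (simp add: orthogonal_commute span_UNIV)
      then show "x = 0" by (simp add: orthogonal_self)
    qed
  qed
qed

text \<open>Pick \<^term>\<open>a \<in> S\<close>, turn its half-space into a slab, and rotate every other vector of \<^term>\<open>S\<close>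
  into the orthogonal complement of \<^term>\<open>a\<close>. Neither step increases the measure, the projected
  vectors are again pairwise non-acute, and there are fewer of them. In the end only the slabs of
  an orthonormal frame are left.\<close>

lemma measure_frame_cell_ge:
  fixes D :: "'a::euclidean_space set"
  assumes D: "D \<in> sets borel" "bounded D"
    and inv: "\<And>y x. y \<bullet> u = 0 \<Longrightarrow> x \<in> D \<Longrightarrow> reflection y x \<in> D"
    and u: "u \<bullet> u = 1"
    and base: "\<And>B. orthonormal_to u B \<Longrightarrow> complete_frame (insert u B) \<Longrightarrow>
        \<kappa> \<le> measure lebesgue (frame_cell D u B {})"
    and E: "orthonormal_to u E"
    and S: "finite S" "\<And>v. v \<in> S \<Longrightarrow> v \<bullet> v = 1 \<and> v \<bullet> u = 0 \<and> (\<forall>e\<in>E. v \<bullet> e = 0)"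
      "\<And>v w. v \<in> S \<Longrightarrow> w \<in> S \<Longrightarrow> v \<noteq> w \<Longrightarrow> v \<bullet> w \<le> 0"
  shows "\<kappa> \<le> measure lebesgue (frame_cell D u E S)"
  using E S
proof (induction "card S" arbitrary: E S rule: less_induct)
  case less
  have finE: "finite E" using less.prems(1) by (simp add: orthonormal_to_def)
  note S = less.prems(2-4)
  show ?case
  proof (cases "S = {}")
    case True
    \<comment> \<open>Additional slabs only shrink the cell, so any completion of \<open>E\<close>
      gives a lower bound.\<close>
    obtain B where B: "E \<subseteq> B" "orthonormal_to u B" "complete_frame (insert u B)"
      using orthonormal_to_extend less.prems(1) u by blast
    have "\<kappa> \<le> measure lebesgue (frame_cell D u B {})"
      using base B by blast
    also have "\<dots> \<le> measure lebesgue (frame_cell D u E S)"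
    proof (rule measure_mono_fmeasurable)
      show "frame_cell D u B {} \<subseteq> frame_cell D u E S"
        using B True by (auto simp: frame_cell_def)
      show "frame_cell D u B {} \<in> sets lebesgue"
        using frame_cell_lmeasurable [OF D, of B "{}" u] B(2) by (simp add: orthonormal_to_def fmeasurableD)
      show "frame_cell D u E S \<in> lmeasurable"
        using frame_cell_lmeasurable [OF D finE S(1)] .
    qed
    finally show ?thesis .
  next
    case False
    then obtain a where a: "a \<in> S" by blast
    have aa: "a \<bullet> a = 1" "a \<bullet> u = 0" "\<And>e. e \<in> E \<Longrightarrow> a \<bullet> e = 0" using S(2) [OF a] by auto
    define pr where "pr v = v - (v \<bullet> a) *\<^sub>R a" for v
    define W where "W v = pr v /\<^sub>R norm (pr v)" for v
    define T where "T = {v \<in> S - {a}. pr v \<noteq> 0}"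
    have finT: "finite T" using S(1) by (simp add: T_def)
    have T: "v \<bullet> v = 1" "v \<bullet> u = 0" "v \<bullet> a \<le> 0" "pr v \<noteq> 0" "v \<in> S" "\<And>e. e \<in> E \<Longrightarrow> v \<bullet> e = 0" 
      if "v \<in> T" for v
      using that S(2) [of v] S(3) [OF _ a] by (auto simp: T_def)
    have pra: "pr v \<bullet> a = 0" for v
      by (simp add: pr_def inner_diff_left aa)
    have prpr: "pr v \<bullet> pr v = v \<bullet> v - (v \<bullet> a)\<^sup>2" for v
      using aa(1) by (simp add: pr_def inner_diff_left inner_diff_right inner_commute power2_eq_square)
    have prx: "v \<bullet> pr w = v \<bullet> w - (v \<bullet> a) * (w \<bullet> a)" for v w
      by (simp add: pr_def inner_diff_right inner_commute)
    have prpr2: "pr v \<bullet> pr w = v \<bullet> w - (v \<bullet> a) * (w \<bullet> a)" for v w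
      using aa(1) by (simp add: pr_def inner_diff_left inner_diff_right inner_commute)
    have Wa: "W v \<bullet> a = 0" for v by (simp add: W_def pra)
    have Wu: "W v \<bullet> u = 0" if "v \<in> T" for v
      using T [OF that] aa by (simp add: W_def pr_def inner_diff_left)
    have We: "W v \<bullet> e = 0" if "v \<in> T" "e \<in> E" for v e
      using T [OF that(1)] aa that by (simp add: W_def pr_def inner_diff_left)
    have WW1: "W v \<bullet> W v = 1" if "v \<in> T" for v
      using T(4) [OF that] by (simp add: W_def dot_square_norm power2_eq_square divide_simps)
    \<comment> \<open>Both \<open>v \<bullet> a\<close> and \<open>w \<bullet> a\<close> are
      nonpositive, so projecting only decreases the inner product of \<open>v\<close> and
      \<open>w\<close>. This is where non-acuteness with \<open>a\<close> is used.\<close>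
    have neg: "v \<bullet> w - (v \<bullet> a) * (w \<bullet> a) \<le> 0" if "v \<in> T" "w \<in> T" "v \<noteq> w" for v w
    proof -
      have "v \<bullet> w \<le> 0" using S(3) [of v w] T(5) that by blast
      moreover have "0 \<le> (v \<bullet> a) * (w \<bullet> a)" using T(3) that by (simp add: mult_nonpos_nonpos)
      ultimately show ?thesis by linarith
    qed
    have vW: "v \<bullet> W w \<le> 0" if "v \<in> T" "w \<in> T" "v \<noteq> w" for v w
      using neg [OF that] unfolding W_def inner_scaleR_right prx
      by (intro mult_nonneg_nonpos) auto
    have WW: "W v \<bullet> W w \<le> 0" if "v \<in> T" "w \<in> T" "v \<noteq> w" for v w
      using neg [OF that] unfolding W_def inner_scaleR_right inner_scaleR_left prpr2
      by (intro mult_nonneg_nonpos) auto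
    let ?E = "insert a E"
    have onE: "orthonormal_to u ?E"
      using less.prems(1) aa by (auto simp: orthonormal_to_def inner_commute)
    have "\<kappa> \<le> measure lebesgue (frame_cell D u ?E (W ` T))"
    proof (rule less.hyps)
      have "card (W ` T) \<le> card T" using finT by (rule card_image_le)
      also have "card T < card S"
        by (rule psubset_card_mono) (use S(1) a in \<open>auto simp: T_def\<close>)
      finally show "card (W ` T) < card S" .
      show "v \<bullet> v = 1 \<and> v \<bullet> u = 0 \<and> (\<forall>e\<in>?E. v \<bullet> e = 0)" if "v \<in> W ` T" for v
        using that WW1 Wu Wa We by auto
      show "v \<bullet> w \<le> 0" if "v \<in> W ` T" "w \<in> W ` T" "v \<noteq> w" for v w
        using that WW by (metis imageE)
    qed (use onE finT in auto)
    also have "\<dots> \<le> measure lebesgue (frame_cell D u ?E T)"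
    proof -
      \<comment> \<open>The vectors are exchanged one at a time. The mixed systems contain both
        projected and original vectors, hence the need for \<open>vW\<close> besides
        \<open>WW\<close>.\<close>
      have "measure lebesgue (frame_cell D u ?E (W ` R \<union> (T - R))) \<le> measure lebesgue (frame_cell D u ?E T)"
        if "finite R" "R \<subseteq> T" for R
        using that
      proof (induction R rule: finite_induct)
        case (insert r R)
        then have r: "r \<in> T" by auto
        let ?Z = "W ` R \<union> (T - insert r R)"
        let ?c = "norm (pr r)" let ?s = "- (r \<bullet> a)"
        have "measure lebesgue (frame_cell D u ?E (insert (W r) ?Z))
           \<le> measure lebesgue (frame_cell D u ?E (insert (?c *\<^sub>R W r - ?s *\<^sub>R a) ?Z))"
        proof (rule measure_frame_cell_rotate [OF D inv])
          show "a \<bullet> W r = 0" using Wa by (simp add: inner_commute)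
          show "?s\<^sup>2 + ?c\<^sup>2 = 1"
            using prpr [of r] T(1) [OF r] by (simp add: power2_norm_eq_inner)
          show "e \<bullet> a = 0 \<and> e \<bullet> W r = 0" if "e \<in> ?E" "e \<noteq> a" for e
          proof -
            have "e \<in> E" using that by simp
            then show ?thesis using We [OF r] aa(3) by (metis inner_commute)
          qed
          show "z \<bullet> a \<le> 0 \<and> z \<bullet> W r \<le> 0" if "z \<in> ?Z" for z
          proof (cases "z \<in> W ` R")
            case True
            then obtain q where q: "q \<in> R" "z = W q" by blast
            with insert have "q \<in> T" "q \<noteq> r" by auto
            then show ?thesis using WW [of q r] r Wa q by simp
          next
            case False
            with that have "z \<in> T" "z \<noteq> r" by auto
            then show ?thesis using vW [of z r] r T(3) by simp
          qed
        qed (use aa WW1 Wu r T(3,4) finE finT insert.hyps in auto)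
        moreover have "?c *\<^sub>R W r - ?s *\<^sub>R a = r"
          using T(4) [OF r] by (simp add: W_def) (simp add: pr_def)
        moreover have "insert r ?Z = W ` R \<union> (T - R)"
          using r insert.hyps by auto
        moreover have "insert (W r) ?Z = W ` insert r R \<union> (T - insert r R)"
          by auto
        ultimately have "measure lebesgue (frame_cell D u ?E (W ` insert r R \<union> (T - insert r R)))
            \<le> measure lebesgue (frame_cell D u ?E (W ` R \<union> (T - R)))"
          by (simp only:)
        also have "\<dots> \<le> measure lebesgue (frame_cell D u ?E T)"
          using insert.IH insert.prems by blast
        finally show ?case .
      qed simp
      from this [OF finT subset_refl] show ?thesis by simp
    qed
    also have "\<dots> \<le> measure lebesgue (frame_cell D u E S)"
    proof (rule measure_mono_fmeasurable)
      show "frame_cell D u ?E T \<in> sets lebesgue"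
        using frame_cell_lmeasurable [OF D, of ?E T u] finE finT by (simp add: fmeasurableD)
      show "frame_cell D u E S \<in> lmeasurable"
        using frame_cell_lmeasurable [OF D finE S(1)] .
      show "frame_cell D u ?E T \<subseteq> frame_cell D u E S"
      proof
        fix x assume x: "x \<in> frame_cell D u ?E T"
        have "v \<bullet> x < u \<bullet> x" if v: "v \<in> S" for v
        proof (cases "v \<in> T \<or> v = a")
          case False
          then have v2: "v = (v \<bullet> a) *\<^sub>R a" using v by (auto simp: T_def pr_def)
          have "(v \<bullet> a)\<^sup>2 = 1"
          proof -
            have "v \<bullet> v = v \<bullet> ((v \<bullet> a) *\<^sub>R a)" using v2 by (rule arg_cong)
            then show ?thesis using S(2) [OF v] by (simp add: power2_eq_square)
          qed
          then have "\<bar>v \<bullet> a\<bar> = 1" by (simp add: abs_square_eq_1)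
          moreover have "\<bar>v \<bullet> x\<bar> = \<bar>v \<bullet> a\<bar> * \<bar>a \<bullet> x\<bar>"
          proof -
            have "v \<bullet> x = ((v \<bullet> a) *\<^sub>R a) \<bullet> x" using v2 by (rule arg_cong)
            then show ?thesis by (simp add: abs_mult)
          qed
          ultimately have "v \<bullet> x \<le> \<bar>a \<bullet> x\<bar>" by simp
          with x show ?thesis by (simp add: frame_cell_def)
        qed (use x in \<open>auto simp: frame_cell_def\<close>)
        with x show "x \<in> frame_cell D u E S" by (auto simp: frame_cell_def)
      qed
    qed
    finally show ?thesis .
  qed
qed

section \<open>Measure and opening angle of the cell of a complete frame\<close>

lemma orthonormal_to_insert:
  fixes u :: "'a::euclidean_space"
  assumes B: "orthonormal_to u B" and u: "u \<bullet> u = 1"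
  shows "e \<in> insert u B \<Longrightarrow> e \<bullet> e = 1"
    and "e \<in> insert u B \<Longrightarrow> f \<in> insert u B \<Longrightarrow> e \<noteq> f \<Longrightarrow> e \<bullet> f = 0"
    and "card (insert u B) \<le> DIM('a)"
proof -
  let ?F = "insert u B"
  have F1: "e \<bullet> e = 1" if "e \<in> ?F" for e
    using that B u by (auto simp: orthonormal_to_def)
  have F0: "e \<bullet> f = 0" if "e \<in> ?F" "f \<in> ?F" "e \<noteq> f" for e f
    using that B by (auto simp: orthonormal_to_def inner_commute)
  have "independent ?F"
  proof (rule pairwise_orthogonal_independent)
    show "pairwise orthogonal ?F" using F0 by (auto simp: pairwise_def orthogonal_def)
    show "0 \<notin> ?F" using F1 by force
  qed
  then show "card ?F \<le> DIM('a)"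
    using independent_bound by blast
  show "e \<in> ?F \<Longrightarrow> e \<bullet> e = 1" by (rule F1)
  show "e \<in> ?F \<Longrightarrow> f \<in> ?F \<Longrightarrow> e \<noteq> f \<Longrightarrow> e \<bullet> f = 0" by (rule F0)
qed

text \<open>Off a null set of ties every point has a unique coordinate of largest absolute value,
  say in direction \<open>e\<close> with sign \<open>s\<close>. The reflection exchanging
  \<open>u\<close> and \<open>s *\<^sub>R e\<close> carries the point into the cell of
  \<open>u\<close>, so at most \<open>2 * DIM('a)\<close> copies of that cell cover
  \<open>X\<close>. For \<open>s *\<^sub>R e = u\<close> the mirror vector is 0 and the reflection
  is the identity.\<close>

lemma measure_shell_le_frame_cell:
  fixes u :: "'a::euclidean_space"
  assumes B: "orthonormal_to u B" "complete_frame (insert u B)" and u: "u \<bullet> u = 1"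
    and X: "X \<in> sets borel" "bounded X" "\<And>y x. x \<in> X \<Longrightarrow> reflection y x \<in> X"
  shows "measure lebesgue X \<le> 2 * real DIM('a) * measure lebesgue (frame_cell X u B {})"
proof -
  define F where "F = insert u B"
  define Q where "Q = frame_cell X u B {}"
  have finB: "finite B" and finF: "finite F" using B(1) by (auto simp: orthonormal_to_def F_def)
  note F1 = orthonormal_to_insert(1) [OF B(1) u, folded F_def]
    and F0 = orthonormal_to_insert(2) [OF B(1) u, folded F_def]
    and cardF = orthonormal_to_insert(3) [OF B(1) u, folded F_def]
  have uB: "u \<notin> B" using B(1) u by (auto simp: orthonormal_to_def)
  \<comment> \<open>Besides the ties, the hyperplane \<open>u \<bullet> x = 0\<close> is removed, so
    that the largest coordinate is nonzero and has a sign.\<close>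
  define N where "N = (\<Union>(e, f, s)\<in>{(e, f, s). e \<in> F \<and> f \<in> F \<and> e \<noteq> f \<and> s \<in> {1, -1::real}}. {x. (e - s *\<^sub>R f) \<bullet> x = 0}) \<union> {x. u \<bullet> x = 0}"
  have "negligible N"
    unfolding N_def
  proof (intro negligible_Un negligible_Union_nat negligible_hyperplane)
    have fin: "finite {(e, f, s). e \<in> F \<and> f \<in> F \<and> e \<noteq> f \<and> s \<in> {1, -1::real}}"
      by (rule finite_subset [of _ "F \<times> F \<times> {1,-1}"]) (use finF in auto)
    show "negligible (\<Union>(e, f, s)\<in>{(e, f, s). e \<in> F \<and> f \<in> F \<and> e \<noteq> f \<and> s \<in> {1, -1::real}}. {x. (e - s *\<^sub>R f) \<bullet> x = 0})"
    proof (rule negligible_Union [OF finite_imageI [OF fin]], clarify)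
      fix e f and s :: real assume ef: "e \<in> F" "f \<in> F" "e \<noteq> f" 
      have "(e - s *\<^sub>R f) \<bullet> e = 1" using F0 [of f e] F1 [of e] ef by (simp add: inner_diff_left)
      then have "e - s *\<^sub>R f \<noteq> 0" by auto
      then show "negligible {x. (e - s *\<^sub>R f) \<bullet> x = 0}"
        using negligible_hyperplane by blast
    qed
    show "u \<noteq> 0 \<or> (0::real) \<noteq> 0" using u by auto
  qed
  define W where "W = (\<Union>(e, s)\<in>F \<times> {1, -1::real}. reflection (u - s *\<^sub>R e) ` Q)"
  have "X \<subseteq> N \<union> W"
  proof
    fix x assume x: "x \<in> X"
    show "x \<in> N \<union> W"
    proof (cases "x \<in> N")
      case False
      have "Max ((\<lambda>e. \<bar>e \<bullet> x\<bar>) ` F) \<in> (\<lambda>e. \<bar>e \<bullet> x\<bar>) ` F"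
        by (rule Max_in) (use finF in \<open>auto simp: F_def\<close>)
      then obtain e where e: "e \<in> F" "\<bar>e \<bullet> x\<bar> = Max ((\<lambda>e. \<bar>e \<bullet> x\<bar>) ` F)" by auto
      have le: "\<bar>f \<bullet> x\<bar> \<le> \<bar>e \<bullet> x\<bar>" if "f \<in> F" for f
        unfolding e(2) using finF that by simp
      have lt: "\<bar>f \<bullet> x\<bar> < \<bar>e \<bullet> x\<bar>" if "f \<in> F" "f \<noteq> e" for f
      proof (rule ccontr)
        assume "\<not> ?thesis"
        then have "\<bar>f \<bullet> x\<bar> = \<bar>e \<bullet> x\<bar>" using le [OF that(1)] by simp
        then have "e \<bullet> x = f \<bullet> x \<or> e \<bullet> x = - (f \<bullet> x)" by linarith
        then have "\<exists>s\<in>{1, -1}. (e - s *\<^sub>R f) \<bullet> x = 0"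
          by (auto simp: inner_diff_left)
        then show False using False that e(1) by (force simp: N_def)
      qed
      have "u \<bullet> x \<noteq> 0" using False by (auto simp: N_def)
      then have ne: "e \<bullet> x \<noteq> 0"
        using lt [of u] by (cases "e = u") (auto simp: F_def)
      define s where "s = sgn (e \<bullet> x)"
      have s: "s = 1 \<or> s = -1" "s * (e \<bullet> x) = \<bar>e \<bullet> x\<bar>"
        using ne by (auto simp: s_def sgn_if)
      define w where "w = u - s *\<^sub>R e"
      define y where "y = reflection w x"
      have ss: "s * s = 1" using s by auto
      \<comment> \<open>As \<open>u\<close> and \<open>s *\<^sub>R e\<close> have equal norm, this
        holds and the \<open>u\<close>-coordinate of the image becomes
        \<open>u \<bullet> x - w \<bullet> x\<close>.\<close>
      have ww: "w \<bullet> w = 2 * (u \<bullet> w)"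
        using u F1 [OF e(1)] ss by (simp add: w_def inner_diff_left inner_diff_right inner_commute algebra_simps)
      have uy: "u \<bullet> y = \<bar>e \<bullet> x\<bar>"
      proof (cases "w = 0")
        case True
        then have "u \<bullet> x = s * (e \<bullet> x)" by (simp add: w_def)
        with True s(2) show ?thesis by (simp add: y_def reflection_def)
      next
        case False
        then have "u \<bullet> w \<noteq> 0" using ww by auto
        then have "u \<bullet> y = u \<bullet> x - w \<bullet> x"
          by (simp add: y_def inner_reflection ww)
        also have "\<dots> = s * (e \<bullet> x)" by (simp add: w_def inner_diff_left)
        finally show ?thesis using s(2) by simp
      qed
      have "\<bar>b \<bullet> y\<bar> < u \<bullet> y" if b: "b \<in> B" for b
      proof (cases "b = e")
        case False
        have "b \<bullet> u = 0" "b \<bullet> e = 0" using b F0 e(1) False uB by (auto simp: F_def)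
        then have "b \<bullet> w = 0" by (simp add: w_def inner_diff_right)
        then have "b \<bullet> y = b \<bullet> x" by (simp add: y_def inner_reflection)
        then show ?thesis using lt [of b] b False uy by (simp add: F_def)
      next
        case True
        then have "e \<noteq> u" using b uB by auto
        then have eu: "e \<bullet> u = 0" using F0 e(1) by (simp add: F_def)
        have "u \<bullet> w = 1" using u eu by (simp add: w_def inner_diff_right inner_commute)
        moreover have "e \<bullet> w = - s" using F1 [OF e(1)] eu by (simp add: w_def inner_diff_right)
        ultimately have "e \<bullet> y = e \<bullet> x + s * (w \<bullet> x)"
          by (simp add: y_def inner_reflection ww)
        also have "\<dots> = s * (u \<bullet> x)"
          using ss by (simp add: w_def inner_diff_left algebra_simps flip: mult.assoc)
        finally have "\<bar>e \<bullet> y\<bar> = \<bar>u \<bullet> x\<bar>" using s(1) by (auto simp: abs_mult)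
        then show ?thesis using lt [of u] \<open>e \<noteq> u\<close> uy True by (simp add: F_def)
      qed
      then have "y \<in> Q"
        using X(3) [OF x] uy ne by (auto simp: Q_def frame_cell_def y_def)
      moreover have "x = reflection w y" by (simp add: y_def)
      ultimately have "x \<in> reflection w ` Q" by blast
      then have "x \<in> W"
        unfolding W_def w_def using e(1) s(1) by (intro UN_I [of "(e, s)"]) auto
      then show ?thesis by simp
    qed simp
  qed
  have Q: "Q \<in> sets borel" "bounded Q"
    unfolding Q_def by (intro frame_cell_borel X finB finite.emptyI bounded_subset [OF X(2) frame_cell_subset])+
  have lmQ: "reflection w ` Q \<in> lmeasurable" for w
    by (intro lmeasurable_bounded_borel reflection_image_borel bounded_reflection_image Q)
  have finI: "finite (F \<times> {1, -1::real})" using finF by simp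
  have lmW: "W \<in> lmeasurable"
    unfolding W_def using finI lmQ by (intro fmeasurable.finite_UN) auto
  have lmN: "N \<in> lmeasurable" using \<open>negligible N\<close> by (rule negligible_imp_measurable)
  have "measure lebesgue X \<le> measure lebesgue (N \<union> W)"
    by (rule measure_mono_fmeasurable [OF \<open>X \<subseteq> N \<union> W\<close>])
       (use X lmN lmW in \<open>auto intro: fmeasurable.Un\<close>)
  also have "\<dots> \<le> measure lebesgue N + measure lebesgue W"
    by (intro measure_Un_le fmeasurableD lmN lmW)
  also have "measure lebesgue N = 0" using \<open>negligible N\<close> by (rule negligible_imp_measure0)
  also have "measure lebesgue W \<le> (\<Sum>(e, s)\<in>F \<times> {1, -1::real}. measure lebesgue (reflection (u - s *\<^sub>R e) ` Q))"
    unfolding W_def using measure_UNION_le [OF finI, of "\<lambda>(e,s). reflection (u - s *\<^sub>R e) ` Q" lebesgue] lmQ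
    by (auto simp: fmeasurableD split_def)
  also have "\<dots> = (\<Sum>(e, s)\<in>F \<times> {1, -1::real}. measure lebesgue Q)"
    by (intro sum.cong refl) (use Q in \<open>auto simp: measure_reflection_image\<close>)
  also have "\<dots> = 2 * real (card F) * measure lebesgue Q"
    by (simp add: split_def card_cartesian_product card_insert_if)
  also have "\<dots> \<le> 2 * real DIM('a) * measure lebesgue Q"
    using cardF by (intro mult_right_mono) auto
  finally show ?thesis by (simp add: Q_def)
qed

text \<open>The squared norm is a sum of at most \<open>DIM('a)\<close> squared coordinates, none of
  which exceeds \<open>u \<bullet> x\<close> in absolute value. Hence intersecting with the cone of
  the overview removes nothing once the frame is complete.\<close>

lemma norm_le_frame_cell:
  fixes u :: "'a::euclidean_space"
  assumes B: "orthonormal_to u B" "complete_frame (insert u B)" and u: "u \<bullet> u = 1"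
    and x: "x \<in> frame_cell X u B {}"
  shows "norm x \<le> sqrt (real DIM('a)) * (u \<bullet> x)"
proof -
  define F where "F = insert u B"
  have finF: "finite F" using B(1) by (auto simp: orthonormal_to_def F_def)
  note F1 = orthonormal_to_insert(1) [OF B(1) u, folded F_def]
    and F0 = orthonormal_to_insert(2) [OF B(1) u, folded F_def]
    and cardF = orthonormal_to_insert(3) [OF B(1) u, folded F_def]
  define y where "y = (\<Sum>f\<in>F. (f \<bullet> x) *\<^sub>R f)"
  have ey: "e \<bullet> y = e \<bullet> x" if "e \<in> F" for e
  proof -
    have "e \<bullet> y = (\<Sum>f\<in>F. (f \<bullet> x) * (e \<bullet> f))" by (simp add: y_def inner_sum_right)
    also have "\<dots> = (\<Sum>f\<in>F. if f = e then e \<bullet> x else 0)"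
      by (rule sum.cong) (use F0 F1 that in auto)
    finally show ?thesis using finF that by simp
  qed
  have "\<forall>b\<in>F. b \<bullet> (x - y) = 0" using ey by (simp add: inner_diff_right)
  then have "x = y" using B(2) by (auto simp: complete_frame_def F_def)
  then have "x \<bullet> x = x \<bullet> y" by simp
  also have "\<dots> = (\<Sum>f\<in>F. (f \<bullet> x) * (f \<bullet> x))"
    by (simp add: y_def inner_sum_right inner_commute [of x])
  also have "\<dots> \<le> (\<Sum>f\<in>F. (u \<bullet> x) * (u \<bullet> x))"
  proof (rule sum_mono)
    fix f assume "f \<in> F"
    then have "\<bar>f \<bullet> x\<bar> \<le> u \<bullet> x" using x by (auto simp: F_def frame_cell_def)
    then show "(f \<bullet> x) * (f \<bullet> x) \<le> (u \<bullet> x) * (u \<bullet> x)"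
      using abs_le_square_iff [of "f \<bullet> x" "u \<bullet> x"] by (simp add: power2_eq_square)
  qed
  also have "\<dots> \<le> real DIM('a) * (u \<bullet> x)\<^sup>2"
    using cardF by (simp add: power2_eq_square mult_right_mono)
  finally have "norm x \<le> sqrt (real DIM('a) * (u \<bullet> x)\<^sup>2)"
    unfolding norm_eq_sqrt_inner by (rule real_sqrt_le_mono)
  also have "\<dots> = sqrt (real DIM('a)) * (u \<bullet> x)"
    using x by (simp add: real_sqrt_mult frame_cell_def)
  finally show ?thesis .
qed

section \<open>Spherical cells and the part of a shell left uncovered by the neighbours\<close>

text \<open>The norm condition lets the ball of the neighbour cover the cell; the strict comparisons
  make the cells of distinct directions disjoint.\<close>

definition spherical_cell :: "'a::euclidean_space set \<Rightarrow> 'a set \<Rightarrow> 'a \<Rightarrow> 'a set" where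
  "spherical_cell X T u = {x \<in> X. 0 < u \<bullet> x \<and> norm x \<le> sqrt (real DIM('a)) * (u \<bullet> x)
      \<and> (\<forall>v\<in>T - {u}. v \<bullet> x < u \<bullet> x)}"

lemma spherical_cell_borel:
  assumes "X \<in> sets borel" "finite T"
  shows "spherical_cell X T u \<in> sets borel"
proof -
  have "spherical_cell X T u = frame_cell X u {} (T - {u}) \<inter> {x. norm x \<le> sqrt (real DIM('a)) * (u \<bullet> x)}"
    by (auto simp: spherical_cell_def frame_cell_def)
  moreover have "closed {x. norm x \<le> sqrt (real DIM('a)) * (u \<bullet> x)}"
    by (intro closed_Collect_le continuous_intros)
  ultimately show ?thesis
    using frame_cell_borel [of X "{}" "T - {u}" u] assms by (simp add: borel_closed sets.Int)
qed

text \<open>The remaining directions are first projected to the complement of \<open>u\<close>.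
  Since \<open>v \<bullet> u \<le> 0\<close> and the projection has norm at most 1, the constraint
  of the normalized projection implies that of \<open>v\<close>. The projected system is again
  non-acute, so the reduction to a cross applies.\<close>

lemma measure_spherical_cell_ge:
  fixes u :: "'a::euclidean_space"
  assumes T: "finite T" "\<And>v. v \<in> T \<Longrightarrow> v \<bullet> v = 1" "\<And>v w. v \<in> T \<Longrightarrow> w \<in> T \<Longrightarrow> v \<noteq> w \<Longrightarrow> v \<bullet> w \<le> 0"
    and u: "u \<in> T"
    and X: "X \<in> sets borel" "bounded X" "\<And>y x. x \<in> X \<Longrightarrow> reflection y x \<in> X"
  shows "measure lebesgue X / (2 * real DIM('a)) \<le> measure lebesgue (spherical_cell X T u)"
proof -
  have uu: "u \<bullet> u = 1" using T u by blast
  \<comment> \<open>The cone condition is absorbed into the domain: mirrors orthogonal to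
    \<open>u\<close> preserve both the norm and \<open>u \<bullet> x\<close>.\<close>
  define D where "D = X \<inter> {x. norm x \<le> sqrt (real DIM('a)) * (u \<bullet> x)}"
  have "closed {x. norm x \<le> sqrt (real DIM('a)) * (u \<bullet> x)}"
    by (intro closed_Collect_le continuous_intros)
  then have D: "D \<in> sets borel" "bounded D"
    using X by (auto simp: D_def borel_closed sets.Int bounded_Int)
  define pr where "pr v = v - (v \<bullet> u) *\<^sub>R u" for v
  define W where "W v = pr v /\<^sub>R norm (pr v)" for v
  define S where "S = {v \<in> T - {u}. pr v \<noteq> 0}"
  have finS: "finite S" using T by (simp add: S_def)
  have S: "v \<bullet> v = 1" "v \<bullet> u \<le> 0" "pr v \<noteq> 0" "v \<in> T" if "v \<in> S" for v
    using that T(2) [of v] T(3) [OF _ u] by (auto simp: S_def)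
  have Wu: "W v \<bullet> u = 0" for v
    by (simp add: W_def pr_def inner_diff_left uu)
  have WW1: "W v \<bullet> W v = 1" if "v \<in> S" for v
    using S(3) [OF that] by (simp add: W_def dot_square_norm power2_eq_square divide_simps)
  have WW: "W v \<bullet> W w \<le> 0" if "v \<in> S" "w \<in> S" "v \<noteq> w" for v w
  proof -
    have "v \<bullet> w \<le> 0" using T(3) [of v w] S(4) that by blast
    moreover have "0 \<le> (v \<bullet> u) * (w \<bullet> u)" using S(2) that by (simp add: mult_nonpos_nonpos)
    moreover have "pr v \<bullet> pr w = v \<bullet> w - (v \<bullet> u) * (w \<bullet> u)"
      using uu by (simp add: pr_def inner_diff_left inner_diff_right inner_commute)
    ultimately have "pr v \<bullet> pr w \<le> 0" by linarith
    then show ?thesis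
      unfolding W_def inner_scaleR_right inner_scaleR_left
      by (intro mult_nonneg_nonpos) auto
  qed
  have "measure lebesgue X / (2 * real DIM('a)) \<le> measure lebesgue (frame_cell D u {} (W ` S))"
  proof (rule measure_frame_cell_ge [OF D _ uu])
    show "reflection y x \<in> D" if "y \<bullet> u = 0" "x \<in> D" for y x
      using that X(3) by (auto simp: D_def inner_reflection inner_commute)
    show "measure lebesgue X / (2 * real DIM('a)) \<le> measure lebesgue (frame_cell D u B {})"
      if B: "orthonormal_to u B" "complete_frame (insert u B)" for B
    proof -
      have "frame_cell D u B {} = frame_cell X u B {}"
        using norm_le_frame_cell [OF B uu, of _ X] by (auto simp: frame_cell_def D_def)
      then show ?thesis
        using measure_shell_le_frame_cell [OF B uu X] by (simp add: field_simps)
    qed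
    show "orthonormal_to u {}" by (simp add: orthonormal_to_def)
    show "v \<bullet> v = 1 \<and> v \<bullet> u = 0 \<and> (\<forall>e\<in>{}. v \<bullet> e = 0)" if "v \<in> W ` S" for v
      using that WW1 Wu by auto
    show "v \<bullet> w \<le> 0" if "v \<in> W ` S" "w \<in> W ` S" "v \<noteq> w" for v w
      using that WW by (metis imageE)
  qed (use finS in auto)
  also have "\<dots> \<le> measure lebesgue (spherical_cell X T u)"
  proof (rule measure_mono_fmeasurable)
    show "frame_cell D u {} (W ` S) \<in> sets lebesgue"
      by (rule fmeasurableD, rule frame_cell_lmeasurable) (use D finS in auto)
    show "spherical_cell X T u \<in> lmeasurable"
      by (intro lmeasurable_bounded_borel spherical_cell_borel bounded_subset [OF X(2)] X T)
         (auto simp: spherical_cell_def)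
    show "frame_cell D u {} (W ` S) \<subseteq> spherical_cell X T u"
    proof
      fix x assume x: "x \<in> frame_cell D u {} (W ` S)"
      then have h: "0 < u \<bullet> x" by (simp add: frame_cell_def)
      have "v \<bullet> x < u \<bullet> x" if v: "v \<in> T - {u}" for v
      proof -
        have "v \<bullet> u \<le> 0" using T(3) [of v u] v u by auto
        then have le: "(v \<bullet> u) * (u \<bullet> x) \<le> 0" using h by (simp add: mult_nonpos_nonneg)
        have "v = (v \<bullet> u) *\<^sub>R u + pr v" by (simp add: pr_def)
        then have vx: "v \<bullet> x = (v \<bullet> u) * (u \<bullet> x) + pr v \<bullet> x"
          by (metis inner_add_left inner_scaleR_left)
        show ?thesis
        proof (cases "pr v = 0")
          case True
          then have "v \<bullet> x \<le> 0" using vx le by simp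
          then show ?thesis using h by linarith
        next
          case False
          then have "v \<in> S" using v by (simp add: S_def)
          then have Wx: "W v \<bullet> x < u \<bullet> x" using x by (auto simp: frame_cell_def)
          have "pr v = norm (pr v) *\<^sub>R W v" using False by (simp add: W_def)
          then have prx: "pr v \<bullet> x = norm (pr v) * (W v \<bullet> x)"
            by (metis inner_scaleR_left)
          have "pr v \<bullet> pr v = v \<bullet> v - (v \<bullet> u)\<^sup>2"
            using uu by (simp add: pr_def inner_diff_left inner_diff_right inner_commute power2_eq_square)
          then have "(norm (pr v))\<^sup>2 \<le> 1"
            using S(1) [OF \<open>v \<in> S\<close>] by (simp add: power2_norm_eq_inner)
          then have n1: "norm (pr v) \<le> 1" by (simp add: power_le_one_iff abs_square_le_1)
          have "norm (pr v) * (W v \<bullet> x) < u \<bullet> x"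
          proof (cases "W v \<bullet> x \<le> 0")
            case True
            then have "norm (pr v) * (W v \<bullet> x) \<le> 0" by (simp add: mult_nonneg_nonpos)
            then show ?thesis using h by simp
          next
            case False
            then have "norm (pr v) * (W v \<bullet> x) \<le> 1 * (W v \<bullet> x)" using n1 by (intro mult_right_mono) auto
            then show ?thesis using Wx by simp
          qed
          then show ?thesis using vx prx le by simp
        qed
      qed
      with x h show "x \<in> spherical_cell X T u"
        by (auto simp: spherical_cell_def frame_cell_def D_def)
    qed
  qed
  finally show ?thesis .
qed

text \<open>At radius exactly \<open>sqrt DIM('a)\<close> the neighbouring balls cover the spherical cells only on the
  sphere itself. Taking \<^term>\<open>R\<close> slightly larger leaves room for a shell of positive thickness.\<close>

lemma uncovered_shell_le:
  fixes T :: "'a::euclidean_space set"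
  assumes T: "finite T" "\<And>v. v \<in> T \<Longrightarrow> v \<bullet> v = 1" "\<And>v w. v \<in> T \<Longrightarrow> w \<in> T \<Longrightarrow> v \<noteq> w \<Longrightarrow> v \<bullet> w \<le> 0"
    and R: "sqrt (real DIM('a)) < R" "\<beta>\<^sup>2 - R\<^sup>2 \<le> 4 * (R - sqrt (real DIM('a))) / sqrt (real DIM('a))"
  shows "measure lebesgue {x. R \<le> norm x \<and> norm x < \<beta> \<and> (\<forall>u\<in>T. R \<le> norm (x - 2 *\<^sub>R u))}
      \<le> (1 - real (card T) / (2 * real DIM('a))) * measure lebesgue {x::'a. R \<le> norm x \<and> norm x < \<beta>}"
proof -
  define X where "X = {x::'a. R \<le> norm x \<and> norm x < \<beta>}"
  have "X = ball 0 \<beta> - ball 0 R" by (auto simp: X_def)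
  then have X: "X \<in> sets borel" "bounded X" using bounded_subset [OF bounded_ball Diff_subset] by auto
  have inv: "\<And>y x. x \<in> X \<Longrightarrow> reflection y x \<in> X" by (simp add: X_def)
  let ?C = "spherical_cell X T"
  have lmX: "X \<in> lmeasurable" using X by (rule lmeasurable_bounded_borel)
  have Csub: "?C u \<subseteq> X" for u by (auto simp: spherical_cell_def)
  have lmC: "?C u \<in> lmeasurable" for u
    by (intro lmeasurable_bounded_borel spherical_cell_borel bounded_subset [OF X(2) Csub] X T)
  have lmU: "(\<Union>u\<in>T. ?C u) \<in> lmeasurable"
    using T lmC by (intro fmeasurable.finite_UN) auto
  have d0: "sqrt (real DIM('a)) > 0" by simp
  have near: "norm (x - 2 *\<^sub>R u) < R" if u: "u \<in> T" and x: "x \<in> ?C u" for u x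
  proof -
    let ?t = "norm x" and ?d = "sqrt (real DIM('a))"
    have t: "R \<le> ?t" "?t < \<beta>" and ux: "?t \<le> ?d * (u \<bullet> x)" using x by (auto simp: spherical_cell_def X_def)
    have "R > 0" using R(1) d0 by linarith
    \<comment> \<open>The bound on \<open>\<beta>\<close> is made for this estimate: with
      \<open>?t < \<beta>\<close> and \<open>R / ?d \<le> u \<bullet> x\<close> the right-hand side
      is below \<open>\<beta>\<^sup>2 - 4 * (R - ?d) / ?d\<close>, hence below
      \<open>R\<^sup>2\<close>.\<close>
    have "(norm (x - 2 *\<^sub>R u))\<^sup>2 = ?t\<^sup>2 - 4 * (u \<bullet> x) + 4"
      using T(2) [OF u] by (simp add: power2_norm_eq_inner inner_diff_left inner_diff_right inner_commute algebra_simps)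
    moreover have "?t / ?d \<le> u \<bullet> x" using ux d0 by (simp add: field_simps)
    moreover have "?t\<^sup>2 < \<beta>\<^sup>2" using t \<open>R > 0\<close> by (intro power_strict_mono) auto
    moreover have "R / ?d \<le> ?t / ?d" using t(1) by (simp add: divide_right_mono)
    moreover have "4 * (R - ?d) / ?d = 4 * (R / ?d) - 4" using d0 by (simp add: field_simps)
    ultimately have "(norm (x - 2 *\<^sub>R u))\<^sup>2 < R\<^sup>2" using R(2) by linarith
    then show ?thesis using \<open>R > 0\<close> by (simp add: power2_less_imp_less)
  qed
  have "measure lebesgue {x. R \<le> norm x \<and> norm x < \<beta> \<and> (\<forall>u\<in>T. R \<le> norm (x - 2 *\<^sub>R u))}
      \<le> measure lebesgue (X - (\<Union>u\<in>T. ?C u))"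
  proof (rule measure_mono_fmeasurable)
    show "{x. R \<le> norm x \<and> norm x < \<beta> \<and> (\<forall>u\<in>T. R \<le> norm (x - 2 *\<^sub>R u))} \<subseteq> X - (\<Union>u\<in>T. ?C u)"
    proof clarify
      fix x assume x: "R \<le> norm x" "norm x < \<beta>" "\<forall>u\<in>T. R \<le> norm (x - 2 *\<^sub>R u)"
      then have "x \<notin> ?C u" if "u \<in> T" for u
        using near [OF that, of x] that by fastforce
      then show "x \<in> X - (\<Union>u\<in>T. ?C u)" using x by (auto simp: X_def)
    qed
    have "{x. R \<le> norm x \<and> norm x < \<beta> \<and> (\<forall>u\<in>T. R \<le> norm (x - 2 *\<^sub>R u))}
       = X \<inter> (\<Inter>u\<in>T. {x. R \<le> norm (x - 2 *\<^sub>R u)})" by (auto simp: X_def)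
    moreover have "closed (\<Inter>u\<in>T. {x. R \<le> norm (x - 2 *\<^sub>R u)})"
      by (intro closed_INT ballI closed_Collect_le continuous_intros)
    ultimately show "{x. R \<le> norm x \<and> norm x < \<beta> \<and> (\<forall>u\<in>T. R \<le> norm (x - 2 *\<^sub>R u))} \<in> sets lebesgue"
      using X by (simp add: borel_closed sets.Int)
    show "X - (\<Union>u\<in>T. ?C u) \<in> lmeasurable"
      using lmX lmU by (simp add: fmeasurable.Diff)
  qed
  also have "\<dots> = measure lebesgue X - measure lebesgue (\<Union>u\<in>T. ?C u)"
    using lmX lmU Csub by (intro measurable_measure_Diff) (auto simp: fmeasurableD)
  also have "measure lebesgue (\<Union>u\<in>T. ?C u) = (\<Sum>u\<in>T. measure lebesgue (?C u))"
  proof (rule measure_negligible_finite_Union_image [OF T(1) lmC])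
    show "pairwise (\<lambda>u v. negligible (?C u \<inter> ?C v)) T"
    proof (rule pairwiseI)
      fix u v assume "u \<in> T" "v \<in> T" "u \<noteq> v"
      have False if "x \<in> ?C u" "x \<in> ?C v" for x
      proof -
        have "v \<bullet> x < u \<bullet> x" using that(1) \<open>v \<in> T\<close> \<open>u \<noteq> v\<close> by (simp add: spherical_cell_def)
        moreover have "u \<bullet> x < v \<bullet> x" using that(2) \<open>u \<in> T\<close> \<open>u \<noteq> v\<close> by (simp add: spherical_cell_def)
        ultimately show False by simp
      qed
      then have "?C u \<inter> ?C v = {}" by blast
      then show "negligible (?C u \<inter> ?C v)" by simp
    qed
  qed
  also have "measure lebesgue X - (\<Sum>u\<in>T. measure lebesgue (?C u)) \<le> measure lebesgue X - (\<Sum>u\<in>T. measure lebesgue X / (2 * real DIM('a)))"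
  proof (intro diff_left_mono sum_mono)
    fix u assume "u \<in> T"
    then show "measure lebesgue X / (2 * real DIM('a)) \<le> measure lebesgue (?C u)"
      by (intro measure_spherical_cell_ge T X inv)
  qed
  also have "\<dots> = (1 - real (card T) / (2 * real DIM('a))) * measure lebesgue X"
    by (simp add: algebra_simps)
  finally show ?thesis
    by (simp add: X_def)
qed

section \<open>The Brunn--Minkowski inequality\<close>

definition msum :: "'a::euclidean_space set \<Rightarrow> 'a set \<Rightarrow> 'a set" where
  "msum A B = {x + y |x y. x \<in> A \<and> y \<in> B}"

lemma compact_msum: "compact A \<Longrightarrow> compact B \<Longrightarrow> compact (msum A B)"
  unfolding msum_def by (rule compact_sums)

lemma msum_mono: "A \<subseteq> A' \<Longrightarrow> B \<subseteq> B' \<Longrightarrow> msum A B \<subseteq> msum A' B'"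
  unfolding msum_def by blast

lemma msum_commute: "msum A B = msum B (A :: 'a::euclidean_space set)"
proof -
  have "msum A B \<subseteq> msum B A" for A B :: "'a set"
  proof
    fix z assume "z \<in> msum A B"
    then obtain x y where "z = x + y" "x \<in> A" "y \<in> B" by (auto simp: msum_def)
    then have "z = y + x \<and> y \<in> B \<and> x \<in> A" by (simp add: add.commute)
    then show "z \<in> msum B A" unfolding msum_def by blast
  qed
  then show ?thesis by blast
qed

text \<open>Positive measures are part of the predicate because the inequality fails for an empty
  summand, whose Minkowski sum with any set is empty. For null pieces produced by cutting it holds
  vacuously.\<close>

definition brunn_minkowski :: "'a::euclidean_space set \<Rightarrow> 'a set \<Rightarrow> bool" where
  "brunn_minkowski A B \<longleftrightarrow> (0 < measure lebesgue A \<longrightarrow> 0 < measure lebesgue B \<longrightarrow>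
     (measure lebesgue A powr (1 / DIM('a)) + measure lebesgue B powr (1 / DIM('a))) powr DIM('a)
       \<le> measure lebesgue (msum A B))"

lemma brunn_minkowski_commute: "brunn_minkowski A B \<longleftrightarrow> brunn_minkowski B A"
  by (auto simp: brunn_minkowski_def msum_commute add.commute)

text \<open>This is the Brunn-Minkowski inequality for boxes with side lengths \<open>p\<close> and
  \<open>q\<close>. The arithmetic-geometric mean inequality is applied to the ratios
  \<open>p i / (p i + q i)\<close> and \<open>q i / (p i + q i)\<close>, whose arithmetic means add
  up to 1.\<close>

lemma prod_powr_superadditive:
  fixes p q :: "'b \<Rightarrow> real"
  assumes I: "finite I" "I \<noteq> {}" and pq: "\<And>i. i \<in> I \<Longrightarrow> 0 < p i" "\<And>i. i \<in> I \<Longrightarrow> 0 < q i"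
  shows "(prod p I powr (1 / card I) + prod q I powr (1 / card I)) powr card I \<le> (\<Prod>i\<in>I. p i + q i)"
proof -
  let ?n = "real (card I)"
  define s where "s i = p i + q i" for i
  have n: "?n > 0" using I by (simp add: card_gt_0_iff)
  have s: "s i > 0" if "i \<in> I" for i using pq [OF that] by (simp add: s_def)
  have S: "prod s I > 0" by (intro prod_pos) (use s in auto)
  have am: "prod f I powr (1 / ?n) \<le> (\<Sum>i\<in>I. f i / s i / ?n) * prod s I powr (1 / ?n)" 
    if "\<And>i. i \<in> I \<Longrightarrow> 0 < f i" for f
  proof -
    have "prod f I = (\<Prod>i\<in>I. f i / s i) * prod s I"
      using S by (simp add: prod_dividef)
    moreover have "(\<Prod>i\<in>I. f i / s i) \<ge> 0" 
      by (intro prod_nonneg) (use that s in \<open>auto simp: less_imp_le\<close>)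
    ultimately have "prod f I powr (1 / ?n) = (\<Prod>i\<in>I. f i / s i) powr (1 / ?n) * prod s I powr (1 / ?n)"
      using S by (simp add: powr_mult)
    also have "(\<Prod>i\<in>I. f i / s i) powr (1 / ?n) \<le> (\<Sum>i\<in>I. f i / s i / ?n)"
      by (rule arith_geom_mean [OF I]) (use that s in \<open>auto simp: less_imp_le\<close>)
    finally show ?thesis by (simp add: mult_right_mono)
  qed
  have "prod p I powr (1 / ?n) + prod q I powr (1 / ?n)
      \<le> ((\<Sum>i\<in>I. p i / s i / ?n) + (\<Sum>i\<in>I. q i / s i / ?n)) * prod s I powr (1 / ?n)"
    using am [of p] am [of q] pq by (simp add: distrib_right add_mono)
  also have "(\<Sum>i\<in>I. p i / s i / ?n) + (\<Sum>i\<in>I. q i / s i / ?n) = (\<Sum>i\<in>I. 1 / ?n)"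
    unfolding sum.distrib [symmetric]
  proof (rule sum.cong)
    fix i assume "i \<in> I"
    then have "p i / s i + q i / s i = 1" using s [of i] by (simp add: s_def flip: add_divide_distrib)
    then show "p i / s i / ?n + q i / s i / ?n = 1 / ?n" by (simp flip: add_divide_distrib)
  qed simp
  also have "\<dots> = 1" using n by simp
  finally have "prod p I powr (1 / ?n) + prod q I powr (1 / ?n) \<le> prod s I powr (1 / ?n)" by simp
  then have "(prod p I powr (1 / ?n) + prod q I powr (1 / ?n)) powr ?n \<le> (prod s I powr (1 / ?n)) powr ?n"
    using n by (intro powr_mono2) auto
  also have "\<dots> = prod s I"
    using n S by (simp add: powr_powr)
  finally show ?thesis by (simp add: s_def)
qed

text \<open>Cutting a union of boxes along a face of one of them leaves that face as a flat remnant
  in the other half, so an excess of measure zero is tolerated. Containing the box bounds Minkowski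
  sums from below.\<close>

definition almost_cbox :: "'a::euclidean_space set \<Rightarrow> bool" where
  "almost_cbox S \<longleftrightarrow> compact S \<and> (\<exists>a b. cbox a b \<subseteq> S \<and> negligible (S - cbox a b))"

lemma almost_cbox_compact: "almost_cbox S \<Longrightarrow> compact S"
  by (simp add: almost_cbox_def)

lemma compact_Int_halfspace:
  assumes "compact (S :: 'a::euclidean_space set)"
  shows "compact (S \<inter> {x. x \<bullet> i \<le> t})" "compact (S \<inter> {x. t \<le> x \<bullet> i})"
  using assms by (auto intro!: compact_Int_closed closed_Collect_le continuous_intros)

lemma almost_cbox_halfspace:
  assumes "almost_cbox (S :: 'a::euclidean_space set)" "i \<in> Basis"
  shows "almost_cbox (S \<inter> {x. x \<bullet> i \<le> t})" "almost_cbox (S \<inter> {x. t \<le> x \<bullet> i})"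
proof -
  obtain a b where S: "compact S" and ab: "cbox a b \<subseteq> S" "negligible (S - cbox a b)"
    using assms by (auto simp: almost_cbox_def)
  have neg: "negligible (S \<inter> H - cbox a b \<inter> H)" for H
    by (rule negligible_subset [OF ab(2)]) auto
  have sub: "cbox a b \<inter> H \<subseteq> S \<inter> H" for H using ab by auto
  obtain c where c: "cbox a b \<inter> {x. x \<bullet> i \<le> t} = cbox a c"
    using interval_split(1) [OF assms(2), of a b t] by blast
  obtain c' where c': "cbox a b \<inter> {x. t \<le> x \<bullet> i} = cbox c' b"
    using interval_split(2) [OF assms(2), of a b t] by blast
  show "almost_cbox (S \<inter> {x. x \<bullet> i \<le> t})"
    unfolding almost_cbox_def
    using compact_Int_halfspace(1) [OF S] neg [of "{x. x \<bullet> i \<le> t}"] sub [of "{x. x \<bullet> i \<le> t}"] unfolding c by blast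
  show "almost_cbox (S \<inter> {x. t \<le> x \<bullet> i})"
    unfolding almost_cbox_def
    using compact_Int_halfspace(2) [OF S] neg [of "{x. t \<le> x \<bullet> i}"] sub [of "{x. t \<le> x \<bullet> i}"] unfolding c' by blast
qed

lemma measure_lebesgue_cbox: "measure lebesgue (cbox a b) = measure lborel (cbox a b)"
  by simp

lemma brunn_minkowski_almost_cbox:
  fixes A B :: "'a::euclidean_space set"
  assumes "almost_cbox A" "almost_cbox B"
  shows "brunn_minkowski A B"
  unfolding brunn_minkowski_def
proof (intro impI)
  assume pos: "0 < measure lebesgue A" "0 < measure lebesgue B"
  obtain a b where A: "compact A" and ab: "cbox a b \<subseteq> A" "negligible (A - cbox a b)"
    using assms by (auto simp: almost_cbox_def)
  obtain a' b' where B: "compact B" and ab': "cbox a' b' \<subseteq> B" "negligible (B - cbox a' b')"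
    using assms by (auto simp: almost_cbox_def)
  have eq: "measure lebesgue S = measure lebesgue (cbox l u)" 
    if "cbox l u \<subseteq> S" "negligible (S - cbox l u)" for S and l u :: 'a
    using that by (intro measure_negligible_symdiff) (auto simp: Diff_eq_empty_iff [THEN iffD2])
  have mA: "measure lebesgue A = measure lborel (cbox a b)" and mB: "measure lebesgue B = measure lborel (cbox a' b')"
    using eq ab ab' by auto
  have ne: "box a b \<noteq> {}" "box a' b' \<noteq> {}"
    using pos mA mB by (metis content_pos_lt_eq box_ne_empty(2))+
  then have lt: "\<And>i. i \<in> Basis \<Longrightarrow> a \<bullet> i < b \<bullet> i" "\<And>i. i \<in> Basis \<Longrightarrow> a' \<bullet> i < b' \<bullet> i"
    by (auto simp: box_ne_empty)
  have cA: "measure lborel (cbox a b) = (\<Prod>i\<in>Basis. b \<bullet> i - a \<bullet> i)"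
    and cB: "measure lborel (cbox a' b') = (\<Prod>i\<in>Basis. b' \<bullet> i - a' \<bullet> i)"
    using lt by (auto intro!: content_cbox less_imp_le)
  have "(measure lebesgue A powr (1 / DIM('a)) + measure lebesgue B powr (1 / DIM('a))) powr DIM('a)
     \<le> (\<Prod>i\<in>Basis. (b \<bullet> i - a \<bullet> i) + (b' \<bullet> i - a' \<bullet> i))"
    unfolding mA mB cA cB
    using prod_powr_superadditive [of "Basis :: 'a set" "\<lambda>i. b \<bullet> i - a \<bullet> i" "\<lambda>i. b' \<bullet> i - a' \<bullet> i"] lt
    by auto
  also have "\<dots> = measure lebesgue (cbox (a + a') (b + b'))"
    unfolding measure_lebesgue_cbox
    using add_strict_mono [OF lt]
    by (subst content_cbox) (auto simp: inner_add_left algebra_simps less_imp_le)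
  also have "\<dots> \<le> measure lebesgue (msum A B)"
  proof (rule measure_mono_fmeasurable)
    show "cbox (a + a') (b + b') \<subseteq> msum A B"
    proof
      fix x assume x: "x \<in> cbox (a + a') (b + b')"
      \<comment> \<open>Coordinatewise the least admissible first summand: not below
        \<open>a\<close>, and large enough for \<open>x - y\<close> not to exceed
        \<open>b'\<close>.\<close>
      define y where "y = (\<Sum>i\<in>Basis. max (a \<bullet> i) (x \<bullet> i - b' \<bullet> i) *\<^sub>R i)"
      have yi: "y \<bullet> i = max (a \<bullet> i) (x \<bullet> i - b' \<bullet> i)" if "i \<in> Basis" for i
        using that by (simp add: y_def)
      have "y \<in> cbox a b" "x - y \<in> cbox a' b'"
        using x lt by (force simp: mem_box yi inner_diff_left inner_add_left max_def)+
      then have "x = y + (x - y) \<and> y \<in> A \<and> x - y \<in> B"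
        using ab ab' by auto
      then show "x \<in> msum A B"
        unfolding msum_def by blast
    qed
    show "msum A B \<in> lmeasurable" using A B by (intro lmeasurable_compact compact_msum)
  qed auto
  finally show "(measure lebesgue A powr (1 / DIM('a)) + measure lebesgue B powr (1 / DIM('a))) powr DIM('a)
     \<le> measure lebesgue (msum A B)" .
qed

section \<open>Cutting a compact set in a prescribed volume ratio\<close>

lemma measure_halfspace_split:
  fixes S :: "'a::euclidean_space set"
  assumes "compact S" "i \<in> Basis"
  shows "measure lebesgue S = measure lebesgue (S \<inter> {x. x \<bullet> i \<le> t}) + measure lebesgue (S \<inter> {x. t \<le> x \<bullet> i})"
proof -
  have "negligible {x. x \<bullet> i = t}"
    using negligible_standard_hyperplane [OF assms(2)] by simp
  then have "negligible (S \<inter> {x. x \<bullet> i \<le> t} \<inter> (S \<inter> {x. t \<le> x \<bullet> i}))"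
    by (rule negligible_subset) auto
  moreover have "(S \<inter> {x. x \<bullet> i \<le> t}) \<union> (S \<inter> {x. t \<le> x \<bullet> i}) = S" by auto
  ultimately show ?thesis
    using measure_Un3 [OF lmeasurable_compact [OF compact_Int_halfspace(1) [OF assms(1)]]
         lmeasurable_compact [OF compact_Int_halfspace(2) [OF assms(1)]], of i t t i]
    by (simp add: negligible_imp_measure0)
qed

text \<open>Intermediate value theorem: the volume below level \<open>t\<close> is Lipschitz in
  \<open>t\<close>, because the part of \<open>S\<close> between two levels lies in a box with side
  \<open>t' - t\<close> in direction \<open>i\<close> and sides \<open>2 * M\<close> in all
  others.\<close>

lemma exists_halfspace_measure:
  fixes S :: "'a::euclidean_space set"
  assumes S: "compact S" "i \<in> Basis" and th: "0 \<le> \<theta>" "\<theta> \<le> measure lebesgue S"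
  obtains t where "measure lebesgue (S \<inter> {x. x \<bullet> i \<le> t}) = \<theta>"
proof -
  define g where "g t = measure lebesgue (S \<inter> {x. x \<bullet> i \<le> t})" for t
  obtain M where M: "M > 0" "\<And>x. x \<in> S \<Longrightarrow> norm x \<le> M"
    using compact_imp_bounded [OF S(1)] bounded_pos by blast
  have xj: "- M \<le> x \<bullet> j \<and> x \<bullet> j \<le> M" if "x \<in> S" "j \<in> Basis" for x j
    using M(2) [OF that(1)] Basis_le_norm [OF that(2), of x] by auto
  have lm: "S \<inter> {x. x \<bullet> i \<le> t} \<in> lmeasurable" for t
    using compact_Int_halfspace [OF S(1)] by (intro lmeasurable_compact)
  define C where "C = (2 * M) ^ (DIM('a) - 1)"
  have step: "g t' - g t \<le> C * (t' - t)" "g t \<le> g t'" if "t \<le> t'" for t t'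
  proof -
    let ?l = "\<Sum>j\<in>Basis. (if j = i then t else - M) *\<^sub>R j" and ?u = "\<Sum>j\<in>Basis. (if j = i then t' else M) *\<^sub>R j"
    show "g t \<le> g t'"
      unfolding g_def using that by (intro measure_mono_fmeasurable lm) (auto simp: fmeasurableD lm)
    have "g t' \<le> measure lebesgue ((S \<inter> {x. x \<bullet> i \<le> t}) \<union> cbox ?l ?u)"
      unfolding g_def
    proof (rule measure_mono_fmeasurable)
      show "S \<inter> {x. x \<bullet> i \<le> t'} \<subseteq> S \<inter> {x. x \<bullet> i \<le> t} \<union> cbox ?l ?u"
      proof
        fix x assume x: "x \<in> S \<inter> {x. x \<bullet> i \<le> t'}"
        show "x \<in> S \<inter> {x. x \<bullet> i \<le> t} \<union> cbox ?l ?u"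
        proof (cases "x \<bullet> i \<le> t")
          case False
          then have "x \<in> cbox ?l ?u" using x xj by (auto simp: mem_box)
          then show ?thesis by simp
        qed (use x in simp)
      qed
    qed (use lm fmeasurableD fmeasurable.Un lmeasurable_cbox in blast)+
    also have "\<dots> \<le> g t + measure lebesgue (cbox ?l ?u)"
      unfolding g_def by (intro measure_Un_le fmeasurableD lm lmeasurable_cbox)
    also have "measure lebesgue (cbox ?l ?u) = measure lborel (cbox ?l ?u)"
      by simp
    also have "measure lborel (cbox ?l ?u) = (\<Prod>j\<in>Basis. if j = i then t' - t else 2 * M)"
      using that M by (subst content_cbox) (auto intro!: prod.cong)
    also have "\<dots> = (t' - t) * (\<Prod>j\<in>Basis - {i}. 2 * M)"
      using S(2) by (subst prod.remove [of _ i]) (auto intro!: prod.cong)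
    also have "\<dots> = C * (t' - t)"
      using S(2) by (simp add: C_def)
    finally show "g t' - g t \<le> C * (t' - t)" by simp
  qed
  have "C \<ge> 0" using M by (simp add: C_def)
  then have "C-lipschitz_on {-M-1..M} g"
  proof (intro lipschitz_onI)
    fix x y
    show "dist (g x) (g y) \<le> C * dist x y"
      using step [of x y] step [of y x] by (cases "x \<le> y") (auto simp: dist_real_def abs_if)
  qed
  then have cont: "continuous_on {-M-1..M} g"
    by (rule lipschitz_on_continuous_on)
  have "S \<inter> {x. x \<bullet> i \<le> -M-1} = {}" using xj S(2) by fastforce
  then have "g (-M-1) \<le> \<theta>" using th by (simp add: g_def)
  moreover have "S \<inter> {x. x \<bullet> i \<le> M} = S" using xj S(2) by blast
  then have "\<theta> \<le> g M" using th by (simp add: g_def)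
  ultimately obtain t where "g t = \<theta>"
    using IVT' [of g "-M-1" \<theta> M] cont M by auto
  then show thesis using that by (simp add: g_def)
qed

text \<open>The Hadwiger--Ohmann argument: \<^term>\<open>B\<close> is cut by a parallel hyperplane in the same
  proportion as \<^term>\<open>A\<close>, and the sums of corresponding halves overlap only in a hyperplane.\<close>

lemma brunn_minkowski_cut:
  fixes A B :: "'a::euclidean_space set"
  assumes AB: "compact A" "compact B" and i: "i \<in> Basis"
    and half: "\<And>t'. brunn_minkowski (A \<inter> {x. x \<bullet> i \<le> t}) (B \<inter> {x. x \<bullet> i \<le> t'})"
        "\<And>t'. brunn_minkowski (A \<inter> {x. t \<le> x \<bullet> i}) (B \<inter> {x. t' \<le> x \<bullet> i})"
    and full: "brunn_minkowski (A \<inter> {x. x \<bullet> i \<le> t}) B" "brunn_minkowski (A \<inter> {x. t \<le> x \<bullet> i}) B"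
  shows "brunn_minkowski A B"
  unfolding brunn_minkowski_def
proof (intro impI)
  let ?d = "real DIM('a)"
  define \<mu> where "\<mu> = measure (lebesgue :: 'a measure)"
  assume "0 < measure lebesgue A" "0 < measure lebesgue B"
  then have pos: "0 < \<mu> A" "0 < \<mu> B" by (auto simp: \<mu>_def)
  define A1 A2 where "A1 = A \<inter> {x. x \<bullet> i \<le> t}" and "A2 = A \<inter> {x. t \<le> x \<bullet> i}"
  have A12: "\<mu> A = \<mu> A1 + \<mu> A2"
    unfolding \<mu>_def A1_def A2_def by (rule measure_halfspace_split [OF AB(1) i])
  have cA: "compact A1" "compact A2" using compact_Int_halfspace AB by (auto simp: A1_def A2_def)
  have nn: "0 \<le> \<mu> A1" "0 \<le> \<mu> A2" by (auto simp: \<mu>_def)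
  have mono: "\<mu> (msum A' B') \<le> \<mu> (msum A B)" if "A' \<subseteq> A" "B' \<subseteq> B" "compact A'" "compact B'" for A' B'
    unfolding \<mu>_def using that AB
    by (intro measure_mono_fmeasurable msum_mono fmeasurableD lmeasurable_compact compact_msum) auto
  have "(\<mu> A powr (1 / ?d) + \<mu> B powr (1 / ?d)) powr ?d \<le> \<mu> (msum A B)"
  \<comment> \<open>When one half is null, the other carries the whole volume of \<open>A\<close>
    and is paired with the uncut \<open>B\<close>; the assumptions \<open>full\<close> serve this
    case.\<close>
  proof (cases "\<mu> A1 = 0 \<or> \<mu> A2 = 0")
    case True
    then consider "\<mu> A2 = \<mu> A" | "\<mu> A1 = \<mu> A" using A12 by linarith
    then show ?thesis
    proof cases
      case 1
      then have "(\<mu> A powr (1 / ?d) + \<mu> B powr (1 / ?d)) powr ?d \<le> \<mu> (msum A2 B)"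
        using full(2) pos unfolding brunn_minkowski_def A2_def \<mu>_def by simp
      also have "\<dots> \<le> \<mu> (msum A B)" by (rule mono) (use cA AB in \<open>auto simp: A2_def\<close>)
      finally show ?thesis .
    next
      case 2
      then have "(\<mu> A powr (1 / ?d) + \<mu> B powr (1 / ?d)) powr ?d \<le> \<mu> (msum A1 B)"
        using full(1) pos unfolding brunn_minkowski_def A1_def \<mu>_def by simp
      also have "\<dots> \<le> \<mu> (msum A B)" by (rule mono) (use cA AB in \<open>auto simp: A1_def\<close>)
      finally show ?thesis .
    qed
  next
    case False
    then have p12: "0 < \<mu> A1" "0 < \<mu> A2" using nn by auto
    define \<theta> where "\<theta> = \<mu> A1 / \<mu> A"
    have th: "0 < \<theta>" "0 < 1 - \<theta>" using p12 pos A12 by (auto simp: \<theta>_def field_simps)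
    have mA: "\<mu> A1 = \<theta> * \<mu> A" "\<mu> A2 = (1 - \<theta>) * \<mu> A" using pos A12 by (auto simp: \<theta>_def field_simps)
    have "\<theta> * \<mu> B \<le> 1 * \<mu> B" using th pos by (intro mult_right_mono) auto
    then obtain t' where t': "\<mu> (B \<inter> {x. x \<bullet> i \<le> t'}) = \<theta> * \<mu> B"
      using exists_halfspace_measure [OF AB(2) i, of "\<theta> * \<mu> B"] th pos unfolding \<mu>_def by auto
    define B1 B2 where "B1 = B \<inter> {x. x \<bullet> i \<le> t'}" and "B2 = B \<inter> {x. t' \<le> x \<bullet> i}"
    have cB: "compact B1" "compact B2" using compact_Int_halfspace AB by (auto simp: B1_def B2_def)
    have mB1: "\<mu> B1 = \<theta> * \<mu> B" using t' by (simp add: B1_def)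
    have "\<mu> B = \<mu> B1 + \<mu> B2"
      unfolding \<mu>_def B1_def B2_def by (rule measure_halfspace_split [OF AB(2) i])
    then have mB2: "\<mu> B2 = (1 - \<theta>) * \<mu> B" using mB1 by (simp add: algebra_simps)
    have posB: "0 < \<mu> B1" "0 < \<mu> B2" using mB1 mB2 th pos by auto
    let ?K = "(\<mu> A powr (1 / ?d) + \<mu> B powr (1 / ?d)) powr ?d"
    \<comment> \<open>The bound is homogeneous of degree 1 in the two volumes, so the halves
      contribute the fractions \<open>\<theta>\<close> and \<open>1 - \<theta>\<close> of
      it.\<close>
    have scale: "((s * \<mu> A) powr (1 / ?d) + (s * \<mu> B) powr (1 / ?d)) powr ?d = s * ?K" if "s > 0" for s
    proof -
      have "(s * \<mu> A) powr (1 / ?d) + (s * \<mu> B) powr (1 / ?d) = s powr (1 / ?d) * (\<mu> A powr (1 / ?d) + \<mu> B powr (1 / ?d))"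
        using that pos by (simp add: powr_mult algebra_simps)
      then show ?thesis using that by (simp add: powr_mult powr_powr)
    qed
    have 1: "\<theta> * ?K \<le> \<mu> (msum A1 B1)"
      using half(1) [of t'] p12 posB scale [OF th(1)] mA(1) mB1
      unfolding brunn_minkowski_def A1_def [symmetric] B1_def [symmetric] \<mu>_def by simp
    have 2: "(1 - \<theta>) * ?K \<le> \<mu> (msum A2 B2)"
      using half(2) [of t'] p12 posB scale [OF th(2)] mA(2) mB2
      unfolding brunn_minkowski_def A2_def [symmetric] B2_def [symmetric] \<mu>_def by simp
    have c12: "compact (msum A1 B1)" "compact (msum A2 B2)" using cA cB by (auto intro: compact_msum)
    have "?K = \<theta> * ?K + (1 - \<theta>) * ?K" by (simp add: algebra_simps)
    also have "\<dots> \<le> \<mu> (msum A1 B1) + \<mu> (msum A2 B2)" using 1 2 by linarith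
    also have "\<dots> = \<mu> (msum A1 B1 \<union> msum A2 B2)"
    proof -
      have "msum A1 B1 \<inter> msum A2 B2 \<subseteq> {x. x \<bullet> i = t + t'}"
      proof
        fix z assume "z \<in> msum A1 B1 \<inter> msum A2 B2"
        then obtain x y x' y' where "z = x + y" "x \<in> A1" "y \<in> B1" "z = x' + y'" "x' \<in> A2" "y' \<in> B2"
          unfolding msum_def by blast
        moreover from this have "z \<bullet> i = x \<bullet> i + y \<bullet> i" "z \<bullet> i = x' \<bullet> i + y' \<bullet> i"
          by (metis inner_add_left)+
        ultimately have "z \<bullet> i = x \<bullet> i + y \<bullet> i" "z \<bullet> i = x' \<bullet> i + y' \<bullet> i"
            "x \<bullet> i \<le> t" "y \<bullet> i \<le> t'" "t \<le> x' \<bullet> i" "t' \<le> y' \<bullet> i"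
          by (auto simp: A1_def A2_def B1_def B2_def)
        then show "z \<in> {x. x \<bullet> i = t + t'}" by simp
      qed
      then have "negligible (msum A1 B1 \<inter> msum A2 B2)"
        using negligible_standard_hyperplane [OF i] negligible_subset by blast
      then show ?thesis
        unfolding \<mu>_def using c12
        by (simp add: measure_Un3 lmeasurable_compact negligible_imp_measure0)
    qed
    also have "\<dots> \<le> \<mu> (msum A B)"
    proof -
      have "msum A1 B1 \<union> msum A2 B2 \<subseteq> msum A B"
        by (intro Un_least msum_mono) (auto simp: A1_def A2_def B1_def B2_def)
      then show ?thesis
        unfolding \<mu>_def using c12 AB cA cB
        by (intro measure_mono_fmeasurable fmeasurableD lmeasurable_compact compact_msum compact_Un) auto
    qed
    finally show ?thesis .
  qed
  then show "(measure lebesgue A powr (1 / ?d) + measure lebesgue B powr (1 / ?d)) powr ?d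
       \<le> measure lebesgue (msum A B)" by (simp add: \<mu>_def)
qed

section \<open>Finite unions of boxes as trees of cuts\<close>

text \<open>A derivation is a finite tree of coordinate cuts with almost boxes at its leaves.
  Induction over this tree takes the place of the usual induction on the number of boxes, so no
  decomposition into boxes with disjoint interiors has to be carried along.\<close>

inductive boxlike :: "'a::euclidean_space set \<Rightarrow> bool" where
  box: "almost_cbox S \<Longrightarrow> boxlike S"
| cut: "compact S \<Longrightarrow> i \<in> Basis \<Longrightarrow> boxlike (S \<inter> {x. x \<bullet> i \<le> t}) \<Longrightarrow> boxlike (S \<inter> {x. t \<le> x \<bullet> i}) \<Longrightarrow> boxlike S"

lemma boxlike_compact: "boxlike S \<Longrightarrow> compact S"
  by (induction rule: boxlike.induct) (auto simp: almost_cbox_def)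

text \<open>The position at which the second summand is cut is dictated by a volume ratio and not by
  its own tree. The tree of \<open>S\<close> serves for each half as well, since intersections with
  half-spaces commute.\<close>

lemma boxlike_halfspace:
  assumes "boxlike S" "j \<in> Basis"
  shows "boxlike (S \<inter> {x. x \<bullet> j \<le> s})" "boxlike (S \<inter> {x. s \<le> x \<bullet> j})"
  using assms
proof (induction rule: boxlike.induct)
  case (box S)
  {
    case 1 then show ?case using box almost_cbox_halfspace boxlike.box by blast
  next
    case 2 then show ?case using box almost_cbox_halfspace boxlike.box by blast
  }
next
  case (cut S i t)
  {
    case 1
    show ?case
      by (rule boxlike.cut [of _ i t])
         (use cut 1 compact_Int_halfspace in \<open>simp_all add: Int_ac\<close>)
  next
    case 2
    show ?case
      by (rule boxlike.cut [of _ i t])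
         (use cut 2 compact_Int_halfspace in \<open>simp_all add: Int_ac\<close>)
  }
qed

lemma brunn_minkowski_almost_cbox_boxlike:
  assumes "boxlike B" "almost_cbox A"
  shows "brunn_minkowski B A"
  using assms
proof (induction arbitrary: A rule: boxlike.induct)
  case (box S)
  then show ?case by (simp add: brunn_minkowski_almost_cbox)
next
  case (cut S i t)
  show ?case
    by (rule brunn_minkowski_cut [of _ _ i t])
       (intro cut.hyps cut.IH almost_cbox_halfspace cut.prems almost_cbox_compact [OF cut.prems])+
qed

text \<open>Only the tree of \<open>A\<close> is descended, while \<open>B\<close> is cut wherever
  the ratio demands and stays boxlike. At a leaf \<open>A\<close> is an almost box, the roles are
  exchanged and the tree of \<open>B\<close> is descended.\<close>

lemma brunn_minkowski_boxlike:
  assumes "boxlike A" "boxlike B"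
  shows "brunn_minkowski A B"
  using assms
proof (induction arbitrary: B rule: boxlike.induct)
  case (box S)
  then show ?case using brunn_minkowski_almost_cbox_boxlike brunn_minkowski_commute by blast
next
  case (cut S i t)
  show ?case
    by (rule brunn_minkowski_cut [of _ _ i t])
       (intro cut.hyps cut.IH boxlike_compact [OF cut.prems] boxlike_halfspace cut.prems)+
qed

lemma boxlike_Un_negligible:
  assumes "boxlike S" "compact N" "negligible N"
  shows "boxlike (S \<union> N)"
  using assms
proof (induction arbitrary: N rule: boxlike.induct)
  case (box S)
  then obtain a b where ab: "compact S" "cbox a b \<subseteq> S" "negligible (S - cbox a b)"
    by (auto simp: almost_cbox_def)
  have "negligible (S \<union> N - cbox a b)"
    by (rule negligible_subset [OF negligible_Un [OF ab(3) box.prems(2)]]) auto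
  moreover have "compact (S \<union> N)" "cbox a b \<subseteq> S \<union> N"
    using ab box.prems by auto
  ultimately have "almost_cbox (S \<union> N)" unfolding almost_cbox_def by blast
  then show ?case by (rule boxlike.box)
next
  case (cut S i t)
  have neg: "negligible (N \<inter> H)" for H
    using cut.prems(2) by (rule negligible_subset) auto
  have "boxlike ((S \<union> N) \<inter> {x. x \<bullet> i \<le> t})" "boxlike ((S \<union> N) \<inter> {x. t \<le> x \<bullet> i})"
    unfolding Int_Un_distrib2
    by (intro cut.IH compact_Int_halfspace cut.prems neg)+
  then show ?case
    using cut.hyps cut.prems by (intro boxlike.cut [of "S \<union> N" i t]) auto
qed

lemma boxlike_Int_slabs:
  assumes "boxlike S" "finite J" "J \<subseteq> Basis"
  shows "boxlike (S \<inter> {x. \<forall>j\<in>J. a \<bullet> j \<le> x \<bullet> j \<and> x \<bullet> j \<le> b \<bullet> j})"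
  using assms(2,3)
proof (induction J rule: finite_induct)
  case empty
  then show ?case using assms(1) by simp
next
  case (insert j J)
  then have j: "j \<in> Basis" and IH: "boxlike (S \<inter> {x. \<forall>j\<in>J. a \<bullet> j \<le> x \<bullet> j \<and> x \<bullet> j \<le> b \<bullet> j})" by auto
  have "S \<inter> {x. \<forall>j\<in>insert j J. a \<bullet> j \<le> x \<bullet> j \<and> x \<bullet> j \<le> b \<bullet> j}
     = S \<inter> {x. \<forall>j\<in>J. a \<bullet> j \<le> x \<bullet> j \<and> x \<bullet> j \<le> b \<bullet> j} \<inter> {x. a \<bullet> j \<le> x \<bullet> j} \<inter> {x. x \<bullet> j \<le> b \<bullet> j}"
    by auto
  then show ?case using boxlike_halfspace(1) [OF boxlike_halfspace(2) [OF IH j] j] by simp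
qed

text \<open>The union is cut along the faces of the new box \<open>K\<close>. Beyond a face only a
  part of \<open>S\<close> and a flat piece of \<open>K\<close> remain, which the tolerance for null
  sets absorbs; between all the faces the union is \<open>K\<close> itself.\<close>

lemma boxlike_Un_cbox:
  fixes S :: "'a::euclidean_space set"
  assumes S: "boxlike S"
  shows "boxlike (S \<union> cbox a b)"
proof -
  define K where "K = cbox a b"
  define slab where "slab J = {x::'a. \<forall>j\<in>J. a \<bullet> j \<le> x \<bullet> j \<and> x \<bullet> j \<le> b \<bullet> j}" for J
  have K: "K = slab Basis" by (auto simp: K_def slab_def mem_box)
  have cl: "closed (slab J)" for J
    unfolding slab_def Ball_def
    by (intro closed_Collect_all closed_Collect_imp closed_Collect_conj closed_Collect_le open_Collect_const continuous_intros)
  have cS: "compact S" using S by (rule boxlike_compact)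
  have cK: "compact K" by (simp add: K_def)
  \<comment> \<open>\<open>J\<close> collects the coordinates in which the restriction to the slab
    of \<open>K\<close> has been released: nothing but \<open>K\<close> for \<open>J = {}\<close>,
    the whole union for \<open>J = Basis\<close>.\<close>
  have "boxlike ((S \<union> K) \<inter> slab (Basis - J))" if "finite J" "J \<subseteq> Basis" for J
    using that
  proof (induction J rule: finite_induct)
    case empty
    have "(S \<union> K) \<inter> slab (Basis - {}) = K" using K by auto
    moreover have "almost_cbox K" unfolding almost_cbox_def using cK by (metis Diff_cancel K_def negligible_empty order_refl)
    ultimately show ?case by (simp add: boxlike.box)
  next
    case (insert j J)
    then have j: "j \<in> Basis" by auto
    let ?B = "Basis - insert j J"
    define M where "M = (S \<union> K) \<inter> slab ?B"
    have cM: "compact M" unfolding M_def using cS cK cl by (intro compact_Int_closed compact_Un)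
    have slabS: "boxlike (S \<inter> slab ?B)"
      unfolding slab_def by (rule boxlike_Int_slabs [OF S]) auto
    have face: "boxlike (S \<inter> slab ?B \<inter> H \<union> K \<inter> {x. x \<bullet> j = t})" if "boxlike (S \<inter> slab ?B \<inter> H)" for H t
    proof (rule boxlike_Un_negligible [OF that])
      have "closed {x. x \<bullet> j = t}" by (intro closed_Collect_eq continuous_intros)
      then show "compact (K \<inter> {x. x \<bullet> j = t})" using cK by (intro compact_Int_closed)
      show "negligible (K \<inter> {x. x \<bullet> j = t})"
        using negligible_standard_hyperplane [OF j, of t] by (rule negligible_subset) auto
    qed
    have Ksub: "K \<subseteq> slab ?B" using K by (auto simp: slab_def)
    have Kj: "a \<bullet> j \<le> x \<bullet> j" "x \<bullet> j \<le> b \<bullet> j" if "x \<in> K" for x using that j by (auto simp: K_def mem_box)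
    show ?case
      unfolding M_def [symmetric]
    proof (rule boxlike.cut [OF cM j, of "b \<bullet> j"])
      have "M \<inter> {x. b \<bullet> j \<le> x \<bullet> j} = S \<inter> slab ?B \<inter> {x. b \<bullet> j \<le> x \<bullet> j} \<union> K \<inter> {x. x \<bullet> j = b \<bullet> j}"
        using Ksub Kj by (force simp: M_def)
      then show "boxlike (M \<inter> {x. b \<bullet> j \<le> x \<bullet> j})"
        using face boxlike_halfspace(2) [OF slabS j] by simp
      show "boxlike (M \<inter> {x. x \<bullet> j \<le> b \<bullet> j})"
      proof (rule boxlike.cut [OF compact_Int_halfspace(1) [OF cM] j, of _ _ "a \<bullet> j"])
        have "Basis - J = insert j ?B" using insert j by auto
        then have "M \<inter> {x. x \<bullet> j \<le> b \<bullet> j} \<inter> {x. a \<bullet> j \<le> x \<bullet> j} = (S \<union> K) \<inter> slab (Basis - J)"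
          by (auto simp: M_def slab_def)
        then show "boxlike (M \<inter> {x. x \<bullet> j \<le> b \<bullet> j} \<inter> {x. a \<bullet> j \<le> x \<bullet> j})"
          using insert by simp
        have "M \<inter> {x. x \<bullet> j \<le> b \<bullet> j} \<inter> {x. x \<bullet> j \<le> a \<bullet> j}
            = S \<inter> slab ?B \<inter> ({x. x \<bullet> j \<le> b \<bullet> j} \<inter> {x. x \<bullet> j \<le> a \<bullet> j}) \<union> K \<inter> {x. x \<bullet> j = a \<bullet> j}"
          if "K \<noteq> {}"
        proof -
          have "a \<bullet> j \<le> b \<bullet> j" using that Kj by fastforce
          then show ?thesis using Ksub Kj by (force simp: M_def)
        qed
        moreover have "boxlike (S \<inter> slab ?B \<inter> ({x. x \<bullet> j \<le> b \<bullet> j} \<inter> {x. x \<bullet> j \<le> a \<bullet> j}))"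
          using boxlike_halfspace(1) [OF boxlike_halfspace(1) [OF slabS j] j] by (simp add: Int_assoc)
        ultimately show "boxlike (M \<inter> {x. x \<bullet> j \<le> b \<bullet> j} \<inter> {x. x \<bullet> j \<le> a \<bullet> j})"
          using face by (cases "K = {}") (simp_all add: M_def Int_assoc)
      qed
    qed
  qed
  from this [OF finite_Basis subset_refl] show ?thesis
    by (simp add: slab_def K_def)
qed

lemma boxlike_UN_cbox:
  assumes "finite F" "\<And>X. X \<in> F \<Longrightarrow> \<exists>a b. X = cbox a b"
  shows "boxlike (\<Union>F :: 'a::euclidean_space set)"
  using assms
proof (induction F rule: finite_induct)
  case empty
  have "cbox One (0::'a) = {}" by (simp add: box_eq_empty) (use nonempty_Basis in blast)
  then have "almost_cbox ({} :: 'a set)" unfolding almost_cbox_def by (metis compact_empty empty_Diff negligible_empty order_refl)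
  then show ?case by (simp add: boxlike.box)
next
  case (insert X F)
  then obtain a b where "X = cbox a b" by blast
  moreover have "boxlike (\<Union>F)" using insert by blast
  ultimately show ?case using boxlike_Un_cbox [of "\<Union>F" a b] by (simp add: Un_commute)
qed

text \<open>Finite partial unions of a countable cover of \<open>U\<close> by boxes inside
  \<open>U\<close> increase to \<open>U\<close>. The boxes may overlap.\<close>

lemma open_boxlike_approx:
  fixes U :: "'a::euclidean_space set"
  assumes "open U" "bounded U"
  obtains A where "\<And>n::nat. boxlike (A n)" "\<And>n. A n \<subseteq> U" "(\<lambda>n. measure lebesgue (A n)) \<longlonglongrightarrow> measure lebesgue U"
proof (cases "U = {}")
  case True
  show ?thesis
    by (rule that [of "\<lambda>n. {}"]) (use True boxlike_UN_cbox [of "{}"] in auto)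
next
  case False
  obtain D where D: "countable D" "D \<subseteq> Pow U" "\<And>X. X \<in> D \<Longrightarrow> \<exists>a b. X = cbox a b" "\<Union>D = U"
    using open_countable_Union_open_cbox [OF \<open>open U\<close>] by metis
  then have "D \<noteq> {}" using False by auto
  define A where "A n = \<Union> (from_nat_into D ` {..n})" for n
  have sub: "from_nat_into D n \<in> D" for n using \<open>D \<noteq> {}\<close> by (rule from_nat_into)
  have box: "boxlike (A n)" for n
    unfolding A_def by (rule boxlike_UN_cbox) (use sub D(3) in auto)
  have AU: "A n \<subseteq> U" for n using sub D(4) by (auto simp: A_def)
  have un: "(\<Union>n. A n) = U"
  proof -
    have "(\<Union>n. A n) = \<Union> (range (from_nat_into D))" by (auto simp: A_def)
    also have "range (from_nat_into D) = D" using D(1) \<open>D \<noteq> {}\<close> by (simp add: range_from_nat_into)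
    finally show ?thesis using D(4) by simp
  qed
  have "(\<lambda>n. measure lebesgue (A n)) \<longlonglongrightarrow> measure lebesgue (\<Union>n. A n)"
  proof (rule Lim_measure_incseq)
    show "range A \<subseteq> sets lebesgue"
      using box by (auto intro!: fmeasurableD lmeasurable_compact boxlike_compact)
    show "incseq A" unfolding A_def incseq_def by fastforce
    have "U \<in> lmeasurable" using assms by (rule lmeasurable_open [rotated])
    then show "emeasure lebesgue (\<Union>n. A n) \<noteq> \<infinity>"
      unfolding un by (auto simp: fmeasurable_def)
  qed
  then show ?thesis using that [of A] box AU un by simp
qed

text \<open>The sum enters only through a measurable superset \<open>Y\<close>, which in the
  application is a union of larger balls. Nonempty open sets have positive measure, hence so do
  their approximations eventually.\<close>

lemma brunn_minkowski_open:
  fixes U V :: "'a::euclidean_space set"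
  assumes U: "open U" "bounded U" "U \<noteq> {}" and V: "open V" "bounded V" "V \<noteq> {}"
    and Y: "Y \<in> lmeasurable" "msum U V \<subseteq> Y"
  shows "(measure lebesgue U powr (1 / DIM('a)) + measure lebesgue V powr (1 / DIM('a))) powr DIM('a)
     \<le> measure lebesgue Y"
proof -
  let ?\<mu> = "measure (lebesgue :: 'a measure)"
  obtain A where A: "\<And>n::nat. boxlike (A n)" "\<And>n. A n \<subseteq> U" "(\<lambda>n. ?\<mu> (A n)) \<longlonglongrightarrow> ?\<mu> U"
    using open_boxlike_approx [OF U(1,2)] by metis
  obtain B where B: "\<And>n::nat. boxlike (B n)" "\<And>n. B n \<subseteq> V" "(\<lambda>n. ?\<mu> (B n)) \<longlonglongrightarrow> ?\<mu> V"
    using open_boxlike_approx [OF V(1,2)] by metis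
  have pos: "?\<mu> S > 0" if "open S" "bounded S" "S \<noteq> {}" for S :: "'a set"
  proof -
    have "\<not> negligible S" using that by (simp add: open_not_negligible)
    then have "?\<mu> S \<noteq> 0"
      using that lmeasurable_open negligible_iff_measure by blast
    then show ?thesis by (simp add: zero_less_measure_iff)
  qed
  have "eventually (\<lambda>n. 0 < ?\<mu> (A n) \<and> 0 < ?\<mu> (B n)) sequentially"
    using order_tendstoD(1) [OF A(3) pos [OF U]] order_tendstoD(1) [OF B(3) pos [OF V]]
    by (rule eventually_conj)
  then have "eventually (\<lambda>n. (?\<mu> (A n) powr (1 / DIM('a)) + ?\<mu> (B n) powr (1 / DIM('a))) powr DIM('a) \<le> ?\<mu> Y) sequentially"
  proof (rule eventually_mono)
    fix n assume n: "0 < ?\<mu> (A n) \<and> 0 < ?\<mu> (B n)"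
    have "(?\<mu> (A n) powr (1 / DIM('a)) + ?\<mu> (B n) powr (1 / DIM('a))) powr DIM('a) \<le> ?\<mu> (msum (A n) (B n))"
      using brunn_minkowski_boxlike [OF A(1) B(1), of n n] n unfolding brunn_minkowski_def by blast
    also have "\<dots> \<le> ?\<mu> Y"
    proof (rule measure_mono_fmeasurable)
      show "msum (A n) (B n) \<subseteq> Y" using msum_mono [OF A(2) B(2)] Y(2) by blast
      show "msum (A n) (B n) \<in> sets lebesgue"
        by (intro fmeasurableD lmeasurable_compact compact_msum boxlike_compact A B)
    qed (rule Y)
    finally show "(?\<mu> (A n) powr (1 / DIM('a)) + ?\<mu> (B n) powr (1 / DIM('a))) powr DIM('a) \<le> ?\<mu> Y" .
  qed
  moreover have "(\<lambda>n. (?\<mu> (A n) powr (1 / DIM('a)) + ?\<mu> (B n) powr (1 / DIM('a))) powr DIM('a))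
      \<longlonglongrightarrow> (?\<mu> U powr (1 / DIM('a)) + ?\<mu> V powr (1 / DIM('a))) powr DIM('a)"
    using pos [OF U] pos [OF V] by (intro tendsto_intros A(3) B(3)) (auto simp: add_nonneg_eq_0_iff)
  ultimately show ?thesis
    by (intro tendsto_upperbound) auto
qed

section \<open>Locally separable packings\<close>

definition contact_directions :: "nat \<Rightarrow> (nat \<Rightarrow> 'a::euclidean_space) \<Rightarrow> nat \<Rightarrow> 'a set" where
  "contact_directions n c i = (\<lambda>j. (c j - c i) /\<^sub>R 2) ` {j. j < n \<and> dist (c i) (c j) = 2}"

lemma finite_contact_directions: "finite (contact_directions n c i)"
  by (simp add: contact_directions_def)

lemma contact_direction_unit: "v \<in> contact_directions n c i \<Longrightarrow> v \<bullet> v = 1"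
  by (auto simp: contact_directions_def dist_norm norm_minus_commute dot_square_norm power2_eq_square)

text \<open>A hyperplane separating two tangent balls is their common tangent hyperplane, so it is
  determined by the contact direction.\<close>

lemma contact_directions_obtuse:
  fixes c :: "nat \<Rightarrow> 'a::euclidean_space"
  assumes ls: "locally_separable n c" and i: "i < n"
    and v: "v \<in> contact_directions n c i" "w \<in> contact_directions n c i" "v \<noteq> w"
  shows "v \<bullet> w \<le> 0"
proof -
  define C where "C = {c i} \<union> {c j |j. j < n \<and> dist (c i) (c j) = 2}"
  obtain q k where q: "q \<in> C" "dist (c i) q = 2" "v = (q - c i) /\<^sub>R 2"
    and k: "k \<in> C" "w = (k - c i) /\<^sub>R 2"
    using v by (auto simp: contact_directions_def C_def)
  have vv: "v \<bullet> v = 1" "w \<bullet> w = 1" using contact_direction_unit v by blast+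
  have q': "q = c i + 2 *\<^sub>R v" and k': "k = c i + 2 *\<^sub>R w" using q k by auto
  have "q \<noteq> c i" using q(2) by auto
  moreover have "totally_separable C" using ls i by (simp add: locally_separable_def C_def)
  moreover have "c i \<in> C" by (simp add: C_def)
  ultimately have "\<exists>a b. a \<noteq> 0 \<and> (\<forall>x\<in>cball (c i) 1. a \<bullet> x \<le> b) \<and> (\<forall>x\<in>cball q 1. b \<le> a \<bullet> x)
      \<and> (\<forall>k\<in>C. {x. a \<bullet> x = b} \<inter> ball k 1 = {})"
    using q(1) unfolding totally_separable_def by metis
  then obtain a b where a: "a \<noteq> 0" and b1: "\<And>x. x \<in> cball (c i) 1 \<Longrightarrow> a \<bullet> x \<le> b"
    and b2: "\<And>x. x \<in> cball q 1 \<Longrightarrow> b \<le> a \<bullet> x"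
    and b3: "\<And>k. k \<in> C \<Longrightarrow> {x. a \<bullet> x = b} \<inter> ball k 1 = {}"
    by blast
  have na: "norm a > 0" using a by simp
  have aa: "a \<bullet> sgn a = norm a"
    using na by (simp add: sgn_div_norm dot_square_norm power2_eq_square)
  \<comment> \<open>Evaluating at the points where the balls extend furthest towards each other in
    direction \<open>a\<close> gives \<open>norm a \<le> a \<bullet> v\<close>. So Cauchy-Schwarz is
    an equality and \<open>a\<close> is a positive multiple of \<open>v\<close>.\<close>
  have le1: "a \<bullet> c i + norm a \<le> b"
    using b1 [of "c i + sgn a"] na by (simp add: aa inner_add_right dist_norm norm_sgn)
  have le2: "b \<le> a \<bullet> q - norm a"
    using b2 [of "q - sgn a"] na by (simp add: aa inner_diff_right dist_norm norm_sgn)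
  have aq: "a \<bullet> q = a \<bullet> c i + 2 * (a \<bullet> v)" by (simp add: q' inner_add_right)
  have nv: "norm v = 1" using vv by (simp add: norm_eq_sqrt_inner)
  have "a \<bullet> v \<le> norm a" using norm_cauchy_schwarz [of a v] nv by simp
  with le1 le2 aq have av: "a \<bullet> v = norm a" and b: "b = a \<bullet> c i + norm a" by linarith+
  then have "norm a *\<^sub>R v = norm v *\<^sub>R a"
    using norm_cauchy_schwarz_eq [of a v] nv by simp
  then have av2: "a = norm a *\<^sub>R v" using nv by simp
  have aw: "a \<bullet> w = norm a * (v \<bullet> w)" by (subst av2) simp
  \<comment> \<open>The right-hand side is the distance of the center \<open>k\<close> from the
    hyperplane; below 1, the foot \<open>?x\<close> of the perpendicular would lie inside the open
    ball. What remains is \<open>v \<bullet> w \<le> 0\<close> or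
    \<open>v \<bullet> w \<ge> 1\<close>, and the latter forces \<open>v = w\<close>.\<close>
  have out: "1 \<le> \<bar>2 * (v \<bullet> w) - 1\<bar>"
  proof (rule ccontr)
    assume lt: "\<not> ?thesis"
    let ?x = "k - (2 * (v \<bullet> w) - 1) *\<^sub>R v"
    have "a \<bullet> ?x = a \<bullet> c i + norm a * (2 * (v \<bullet> w)) - (2 * (v \<bullet> w) - 1) * norm a"
      by (simp add: k' inner_diff_right inner_add_right aw av)
    also have "\<dots> = b" by (simp add: b algebra_simps)
    finally have "?x \<in> {x. a \<bullet> x = b}" by simp
    moreover have "?x \<in> ball k 1" using lt nv by (simp add: dist_norm)
    ultimately show False using b3 [OF k(1)] by blast
  qed
  show ?thesis
  proof (rule ccontr)
    assume "\<not> ?thesis"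
    with out have "1 \<le> v \<bullet> w" by linarith
    moreover have "(v - w) \<bullet> (v - w) = 2 - 2 * (v \<bullet> w)"
      using vv by (simp add: inner_diff_left inner_diff_right inner_commute)
    ultimately have "(v - w) \<bullet> (v - w) \<le> 0" by simp
    then have "v - w = 0" by (metis inner_gt_zero_iff not_less)
    then show False using v(3) by simp
  qed
qed

text \<open>Every tangent pair is seen from both of its ends. The packing condition makes
  \<open>c\<close> injective, so distinct neighbours have distinct directions.\<close>

lemma sum_card_contact_directions:
  fixes c :: "nat \<Rightarrow> 'a::euclidean_space"
  assumes "fin_unit_ball_packing n c"
  shows "(\<Sum>i<n. card (contact_directions n c i)) = 2 * contact_number n c"
proof -
  let ?P = "\<lambda>i j. dist (c i) (c j) = 2"
  have inj: "inj_on c {..<n}"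
    using assms by (force simp: inj_on_def fin_unit_ball_packing_def)
  have card: "card (contact_directions n c i) = card {j. j < n \<and> ?P i j}" for i
    unfolding contact_directions_def
  proof (rule card_image)
    show "inj_on (\<lambda>j. (c j - c i) /\<^sub>R 2) {j. j < n \<and> ?P i j}"
      using inj by (auto simp: inj_on_def)
  qed
  let ?L = "{(i, j). i < j \<and> j < n \<and> ?P i j}" and ?G = "{(i, j). j < i \<and> i < n \<and> ?P i j}"
  have fin: "finite ?L" "finite ?G" 
    by (rule finite_subset [of _ "{..<n} \<times> {..<n}"]; auto)+
  have "(\<Sum>i<n. card (contact_directions n c i)) = card (SIGMA i:{..<n}. {j. j < n \<and> ?P i j})"
    by (simp add: card)
  also have "(SIGMA i:{..<n}. {j. j < n \<and> ?P i j}) = ?L \<union> ?G"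
    by (auto simp: nat_neq_iff) (metis dist_self nat_neq_iff zero_neq_numeral)
  also have "card (?L \<union> ?G) = card ?L + card ?G"
    by (rule card_Un_disjoint) (use fin in auto)
  also have "?G = prod.swap ` ?L"
    by (auto simp: image_iff dist_commute)
  also have "card (prod.swap ` ?L) = card ?L"
    by (rule card_image) (auto simp: inj_on_def)
  finally show ?thesis by (simp add: contact_number_def)
qed

section \<open>Truncated Voronoi cells and the density constant\<close>

lemma omega_eq: "omega TYPE('a::euclidean_space) = unit_ball_vol (real DIM('a))"
  by (simp add: omega_def content_cball)

lemma omega_pos: "0 < omega TYPE('a::euclidean_space)"
  by (simp add: omega_eq)

lemma measure_ball_omega: "0 \<le> r \<Longrightarrow> measure lebesgue (ball (p::'a::euclidean_space) r) = omega TYPE('a) * r ^ DIM('a)"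
  by (simp add: omega_eq content_ball)

lemma closed_voronoi_cell: "closed (voronoi_cell C p)"
proof -
  have "voronoi_cell C p = (\<Inter>q\<in>C - {p}. {x. dist x p \<le> dist x q})"
    by (auto simp: voronoi_cell_def)
  also have "closed \<dots>"
    by (intro closed_INT ballI closed_Collect_le continuous_intros)
  finally show ?thesis .
qed

lemma compact_voronoi_cell_cball: "compact (voronoi_cell C p \<inter> cball p r)"
  using compact_Int_closed [OF compact_cball closed_voronoi_cell, of p r C p] by (simp add: Int_commute)

lemma cball_subset_voronoi_cell:
  assumes "unit_ball_packing C" "p \<in> C"
  shows "cball p 1 \<subseteq> voronoi_cell C p"
proof
  fix x assume "x \<in> cball p 1"
  then have x: "dist x p \<le> 1" by (simp add: dist_commute)
  have "dist x p \<le> dist x q" if "q \<in> C" "q \<noteq> p" for q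
  proof -
    have "2 \<le> dist p q" using assms that unfolding unit_ball_packing_def by (metis)
    also have "\<dots> \<le> dist x p + dist x q" by (rule dist_triangle3)
    finally show ?thesis using x by linarith
  qed
  then show "x \<in> voronoi_cell C p" by (simp add: voronoi_cell_def)
qed

lemma omega_le_measure_voronoi_cell:
  fixes p :: "'a::euclidean_space"
  assumes "unit_ball_packing C" "p \<in> C"
  shows "omega TYPE('a) \<le> measure lebesgue (voronoi_cell C p \<inter> cball p (sqrt (real DIM('a))))"
proof -
  have "measure lebesgue (cball p 1) \<le> measure lebesgue (voronoi_cell C p \<inter> cball p (sqrt (real DIM('a))))"
  proof (rule measure_mono_fmeasurable)
    have "1 \<le> sqrt (real DIM('a))" by (simp add: Suc_leI)
    then show "cball p 1 \<subseteq> voronoi_cell C p \<inter> cball p (sqrt (real DIM('a)))"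
      using cball_subset_voronoi_cell [OF assms] subset_cball [of 1 "sqrt (real DIM('a))" p] by blast
  qed (auto intro: lmeasurable_compact compact_voronoi_cell_cball)
  then show ?thesis by (simp add: omega_eq content_cball)
qed

text \<open>A truncated cell contains the unit ball, so all quotients are at most 1 and the real
  supremum really is an upper bound for them.\<close>

lemma delta_hat_bounds:
  fixes p :: "'a::euclidean_space"
  assumes "unit_ball_packing C" "p \<in> C"
  shows "0 < delta_hat TYPE('a)"
    and "omega TYPE('a) / delta_hat TYPE('a)
           \<le> measure lebesgue (voronoi_cell C p \<inter> cball p (sqrt (real DIM('a))))"
proof -
  let ?m = "\<lambda>C (p::'a). measure lebesgue (voronoi_cell C p \<inter> cball p (sqrt (real DIM('a))))"
  let ?S = "{omega TYPE('a) / ?m C p | (C :: 'a set) p. unit_ball_packing C \<and> p \<in> C}"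
  have "bdd_above ?S"
  proof (rule bdd_aboveI)
    fix x assume "x \<in> ?S"
    then obtain C p where "x = omega TYPE('a) / ?m C p" "unit_ball_packing C" "p \<in> C" by blast
    then show "x \<le> 1"
      using omega_le_measure_voronoi_cell [of C p] omega_pos [where 'a='a] by simp
  qed
  then have le: "omega TYPE('a) / ?m C p \<le> delta_hat TYPE('a)"
    unfolding delta_hat_def using assms by (intro cSup_upper) auto
  have m: "0 < ?m C p"
    using omega_le_measure_voronoi_cell [OF assms] omega_pos [where 'a='a] by linarith
  then have "0 < omega TYPE('a) / ?m C p" using omega_pos [where 'a='a] by (rule divide_pos_pos [rotated])
  with le show pos: "0 < delta_hat TYPE('a)" by linarith
  show "omega TYPE('a) / delta_hat TYPE('a) \<le> ?m C p"
    using le m pos by (simp add: field_simps)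
qed

section \<open>Volume and growth of a union of balls\<close>

lemma lmeasurable_UN_ball: "(\<Union>i<n. ball (c i) r) \<in> lmeasurable" for n :: nat and c :: "nat \<Rightarrow> 'a::euclidean_space"
  by (intro fmeasurable.finite_UN) auto

text \<open>Two cells meet only in the bisecting hyperplane of their centers, so their volumes add
  up. The strict inequality for \<open>R\<close> puts the closed truncated cells inside the open
  balls.\<close>

lemma measure_UN_ball_ge:
  fixes c :: "nat \<Rightarrow> 'a::euclidean_space"
  assumes c: "fin_unit_ball_packing n c" and R: "sqrt (real DIM('a)) < R"
  shows "real n * omega TYPE('a) / delta_hat TYPE('a) \<le> measure lebesgue (\<Union>i<n. ball (c i) R)"
proof -
  define C where "C = c ` {..<n}"
  define V where "V i = voronoi_cell C (c i) \<inter> cball (c i) (sqrt (real DIM('a)))" for i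
  have pack: "unit_ball_packing C"
    using c by (auto simp: unit_ball_packing_def C_def fin_unit_ball_packing_def)
  have lmV: "V i \<in> lmeasurable" for i
    unfolding V_def by (intro lmeasurable_compact compact_voronoi_cell_cball)
  have "real n * omega TYPE('a) / delta_hat TYPE('a) = (\<Sum>i<n. omega TYPE('a) / delta_hat TYPE('a))"
    by simp
  also have "\<dots> \<le> (\<Sum>i<n. measure lebesgue (V i))"
    unfolding V_def by (intro sum_mono delta_hat_bounds pack) (auto simp: C_def)
  also have "\<dots> = measure lebesgue (\<Union>i<n. V i)"
  proof (rule measure_negligible_finite_Union_image [symmetric, OF finite_lessThan lmV], rule pairwiseI)
    fix i j assume ij: "i \<in> {..<n}" "j \<in> {..<n}" "i \<noteq> j"
    then have "2 \<le> dist (c i) (c j)" using c by (auto simp: fin_unit_ball_packing_def)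
    then have ne: "c i \<noteq> c j" by auto
    have "V i \<inter> V j \<subseteq> {x. (2 *\<^sub>R (c j - c i)) \<bullet> x = c j \<bullet> c j - c i \<bullet> c i}"
    proof
      fix x assume "x \<in> V i \<inter> V j"
      then have "dist x (c i) = dist x (c j)"
        using ij ne by (intro antisym) (auto simp: V_def voronoi_cell_def C_def)
      then have "(x - c i) \<bullet> (x - c i) = (x - c j) \<bullet> (x - c j)"
        by (simp add: dist_norm norm_eq)
      then show "x \<in> {x. (2 *\<^sub>R (c j - c i)) \<bullet> x = c j \<bullet> c j - c i \<bullet> c i}"
        by (simp add: inner_diff_left inner_diff_right inner_commute algebra_simps)
    qed
    moreover have "negligible {x. (2 *\<^sub>R (c j - c i)) \<bullet> x = c j \<bullet> c j - c i \<bullet> c i}"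
      using ne by (intro negligible_hyperplane) auto
    ultimately show "negligible (V i \<inter> V j)" by (rule negligible_subset [rotated])
  qed
  also have "\<dots> \<le> measure lebesgue (\<Union>i<n. ball (c i) R)"
  proof (rule measure_mono_fmeasurable)
    show "(\<Union>i<n. V i) \<subseteq> (\<Union>i<n. ball (c i) R)"
      using R by (fastforce simp: V_def)
    show "(\<Union>i<n. V i) \<in> sets lebesgue" using lmV by (auto simp: fmeasurableD)
  qed (rule lmeasurable_UN_ball)
  finally show ?thesis .
qed

text \<open>A point gained between the radii has distance in [R, \<beta>) from some
  \<open>c i\<close> and at least \<open>R\<close> from every center, in particular from the
  neighbours of ball \<open>i\<close>. Seen from \<open>c i\<close>, it lies in the uncovered part
  of the shell.\<close>

lemma measure_UN_ball_growth:
  fixes c :: "nat \<Rightarrow> 'a::euclidean_space"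
  assumes ls: "locally_separable n c"
    and R: "sqrt (real DIM('a)) < R" "R \<le> \<beta>" "\<beta>\<^sup>2 - R\<^sup>2 \<le> 4 * (R - sqrt (real DIM('a))) / sqrt (real DIM('a))"
  shows "measure lebesgue (\<Union>i<n. ball (c i) \<beta>) \<le> measure lebesgue (\<Union>i<n. ball (c i) R)
     + (\<Sum>i<n. 1 - real (card (contact_directions n c i)) / (2 * real DIM('a)))
        * (omega TYPE('a) * (\<beta> ^ DIM('a) - R ^ DIM('a)))"
proof -
  let ?T = "contact_directions n c"
  define U where "U i = {x. R \<le> norm x \<and> norm x < \<beta> \<and> (\<forall>u\<in>?T i. R \<le> norm (x - 2 *\<^sub>R u))}" for i
  have R0: "0 \<le> R" using R(1) real_sqrt_ge_zero [of "real DIM('a)"] by linarith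
  have shell: "measure lebesgue {x::'a. R \<le> norm x \<and> norm x < \<beta>} = omega TYPE('a) * (\<beta> ^ DIM('a) - R ^ DIM('a))"
  proof -
    have "{x::'a. R \<le> norm x \<and> norm x < \<beta>} = ball 0 \<beta> - ball 0 R" by auto
    moreover have "measure lebesgue (ball (0::'a) \<beta> - ball 0 R)
        = measure lebesgue (ball (0::'a) \<beta>) - measure lebesgue (ball (0::'a) R)"
      using R(2) by (intro measurable_measure_Diff subset_ball) auto
    ultimately have "measure lebesgue {x::'a. R \<le> norm x \<and> norm x < \<beta>}
        = measure lebesgue (ball (0::'a) \<beta>) - measure lebesgue (ball (0::'a) R)"
      by metis
    also have "\<dots> = omega TYPE('a) * (\<beta> ^ DIM('a) - R ^ DIM('a))"
      using R0 R(2) measure_ball_omega [of R "0::'a"] measure_ball_omega [of \<beta> "0::'a"] by (simp add: right_diff_distrib)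
    finally show ?thesis .
  qed
  have lmU: "U i \<in> lmeasurable" for i
  proof (rule lmeasurable_bounded_borel)
    have "U i = (ball 0 \<beta> - ball 0 R) \<inter> (\<Inter>u\<in>?T i. {x. R \<le> norm (x - 2 *\<^sub>R u)})"
      by (auto simp: U_def)
    moreover have "closed (\<Inter>u\<in>?T i. {x. R \<le> norm (x - 2 *\<^sub>R u)})"
      by (intro closed_INT ballI closed_Collect_le continuous_intros)
    ultimately show "U i \<in> sets borel" by (simp add: borel_closed sets.Int)
    show "bounded (U i)" by (rule bounded_subset [OF bounded_ball [of 0 \<beta>]]) (auto simp: U_def)
  qed
  have mU: "measure lebesgue (U i) \<le> (1 - real (card (?T i)) / (2 * real DIM('a)))
        * (omega TYPE('a) * (\<beta> ^ DIM('a) - R ^ DIM('a)))" if "i < n" for i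
    unfolding U_def shell [symmetric]
    by (rule uncovered_shell_le [OF finite_contact_directions contact_direction_unit
          contact_directions_obtuse [OF ls that] R(1,3)])
  have lmT: "(+) (c i) ` U i \<in> lmeasurable" for i using lmU by (rule measurable_translation)
  have lmUU: "(\<Union>i<n. (+) (c i) ` U i) \<in> lmeasurable"
    using lmT by (intro fmeasurable.finite_UN) auto
  have "measure lebesgue (\<Union>i<n. ball (c i) \<beta>)
      \<le> measure lebesgue ((\<Union>i<n. ball (c i) R) \<union> (\<Union>i<n. (+) (c i) ` U i))"
  proof (rule measure_mono_fmeasurable)
    show "(\<Union>i<n. ball (c i) \<beta>) \<subseteq> (\<Union>i<n. ball (c i) R) \<union> (\<Union>i<n. (+) (c i) ` U i)"
    proof
      fix x assume "x \<in> (\<Union>i<n. ball (c i) \<beta>)"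
      then obtain i where i: "i < n" "dist (c i) x < \<beta>" by auto
      show "x \<in> (\<Union>i<n. ball (c i) R) \<union> (\<Union>i<n. (+) (c i) ` U i)"
      proof (cases "x \<in> (\<Union>i<n. ball (c i) R)")
        case False
        then have far: "R \<le> norm (x - c j)" if "j < n" for j
          using that by (auto simp: dist_norm norm_minus_commute not_less)
        have "x - c i \<in> U i"
          unfolding U_def
        proof (intro CollectI conjI ballI)
          show "R \<le> norm (x - c i)" using far i by simp
          show "norm (x - c i) < \<beta>" using i by (simp add: dist_norm norm_minus_commute)
          fix u assume "u \<in> ?T i"
          then obtain j where "j < n" "u = (c j - c i) /\<^sub>R 2" by (auto simp: contact_directions_def)
          then show "R \<le> norm (x - c i - 2 *\<^sub>R u)" using far [of j] by simp
        qed
        then have "x \<in> (+) (c i) ` U i" by (rule image_eqI [rotated]) simp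
        then show ?thesis using i by blast
      qed simp
    qed
  qed (use lmUU lmeasurable_UN_ball fmeasurable.Un fmeasurableD in blast)+
  also have "\<dots> \<le> measure lebesgue (\<Union>i<n. ball (c i) R) + measure lebesgue (\<Union>i<n. (+) (c i) ` U i)"
    by (intro measure_Un_le fmeasurableD lmUU lmeasurable_UN_ball)
  also have "measure lebesgue (\<Union>i<n. (+) (c i) ` U i) \<le> (\<Sum>i<n. measure lebesgue ((+) (c i) ` U i))"
    using lmT by (intro measure_UNION_le) (auto simp: fmeasurableD)
  also have "\<dots> = (\<Sum>i<n. measure lebesgue (U i))"
    by (simp add: measure_translation)
  also have "\<dots> \<le> (\<Sum>i<n. (1 - real (card (?T i)) / (2 * real DIM('a)))
        * (omega TYPE('a) * (\<beta> ^ DIM('a) - R ^ DIM('a))))"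
    by (intro sum_mono mU) simp
  finally show ?thesis by (simp add: sum_distrib_right)
qed

text \<open>Bernoulli's inequality rescaled. It is used with both signs of \<open>y\<close>:
  expanding outwards for the Brunn-Minkowski bound, and inwards from \<open>\<beta>\<close> for the
  shell volume.\<close>

lemma power_ge_tangent:
  fixes x y :: real
  assumes "0 < x" "0 \<le> x + y" "0 < d"
  shows "x ^ d + real d * x ^ (d - 1) * y \<le> (x + y) ^ d"
proof -
  have "1 + real d * (y / x) \<le> (1 + y / x) ^ d"
    by (rule Bernoulli_inequality) (use assms in \<open>simp add: field_simps\<close>)
  then have "x ^ d * (1 + real d * (y / x)) \<le> x ^ d * (1 + y / x) ^ d"
    using assms by (intro mult_left_mono) auto
  also have "\<dots> = (x * (1 + y / x)) ^ d" by (simp add: power_mult_distrib)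
  also have "x * (1 + y / x) = x + y" using assms by (simp add: field_simps)
  finally have *: "x ^ d * (1 + real d * (y / x)) \<le> (x + y) ^ d" .
  have "x ^ d = x ^ (d - 1) * x" using assms(3) by (metis power_minus_mult)
  then have "x ^ d * (1 + real d * (y / x)) = x ^ d + real d * x ^ (d - 1) * y"
    using assms by (simp add: field_simps)
  with * show ?thesis by simp
qed

lemma isoperimetric_UN_ball:
  fixes c :: "nat \<Rightarrow> 'a::euclidean_space"
  assumes n: "0 < n" and pack: "fin_unit_ball_packing n c" and ls: "locally_separable n c"
    and R: "sqrt (real DIM('a)) < R" "R < \<beta>" "\<beta>\<^sup>2 - R\<^sup>2 \<le> 4 * (R - sqrt (real DIM('a))) / sqrt (real DIM('a))"
  shows "(real n * omega TYPE('a) / delta_hat TYPE('a)) powr ((real DIM('a) - 1) / real DIM('a)) * omega TYPE('a) powr (1 / real DIM('a))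
     \<le> omega TYPE('a) * (real n - real (contact_number n c) / real DIM('a)) * \<beta> ^ (DIM('a) - 1)"
proof -
  let ?d = "DIM('a)" and ?w = "omega TYPE('a)"
  define \<epsilon> where "\<epsilon> = \<beta> - R"
  define V where "V r = measure lebesgue (\<Union>i<n. ball (c i) r)" for r
  define F where "F = real n - real (contact_number n c) / real ?d"
  have d: "0 < ?d" by simp
  have e: "0 < \<epsilon>" using R by (simp add: \<epsilon>_def)
  have R0: "0 < R" using R(1) real_sqrt_ge_zero [of "real ?d"] by linarith
  have "(\<Sum>i<n. 1 - real (card (contact_directions n c i)) / (2 * real ?d))
      = real n - real (\<Sum>i<n. card (contact_directions n c i)) / (2 * real ?d)"
    by (simp add: sum_subtractf sum_divide_distrib)
  also have "\<dots> = F"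
    unfolding sum_card_contact_directions [OF pack] F_def by simp
  finally have grow: "V \<beta> \<le> V R + F * (?w * (\<beta> ^ ?d - R ^ ?d))"
    using measure_UN_ball_growth [OF ls R(1) less_imp_le [OF R(2)] R(3)] by (simp add: V_def)
  have w: "?w > 0" by (rule omega_pos)
  have dh: "0 < delta_hat TYPE('a)"
    by (rule delta_hat_bounds(1) [of "{0}" 0]) (auto simp: unit_ball_packing_def)
  have V0: "real n * ?w / delta_hat TYPE('a) \<le> V R"
    unfolding V_def by (rule measure_UN_ball_ge [OF pack R(1)])
  have pos0: "0 < real n * ?w / delta_hat TYPE('a)" using n w dh by simp
  then have VR: "0 < V R" using V0 by linarith
  define x y where "x = V R powr (1 / ?d)" and "y = ?w powr (1 / ?d)"
  have xy: "0 < x" "0 < y" using VR w by (simp_all add: x_def y_def)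
  have xd: "x ^ ?d = V R"
    using VR d by (simp add: x_def powr_powr flip: powr_realpow)
  have "(V R powr (1 / ?d) + measure lebesgue (ball (0::'a) \<epsilon>) powr (1 / ?d)) powr ?d \<le> V \<beta>"
    unfolding V_def
  proof (rule brunn_minkowski_open)
    show "bounded (\<Union>i<n. ball (c i) R)" by (intro bounded_UN) auto
    show "(\<Union>i<n. ball (c i) R) \<noteq> {}" using n R0 by (auto simp: ball_eq_empty)
    show "(\<Union>i<n. ball (c i) \<beta>) \<in> lmeasurable" by (rule lmeasurable_UN_ball)
    show "msum (\<Union>i<n. ball (c i) R) (ball 0 \<epsilon>) \<subseteq> (\<Union>i<n. ball (c i) \<beta>)"
    proof
      fix z assume "z \<in> msum (\<Union>i<n. ball (c i) R) (ball 0 \<epsilon>)"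
      then obtain p q i where z: "z = p + q" "i < n" "dist (c i) p < R" "norm q < \<epsilon>"
        by (auto simp: msum_def)
      have "dist (c i) z \<le> dist (c i) p + norm q"
        using dist_triangle [of "c i" z p] z(1) by (simp add: dist_norm)
      then show "z \<in> (\<Union>i<n. ball (c i) \<beta>)" using z by (auto simp: \<epsilon>_def intro!: bexI [of _ i])
    qed
  qed (use e in auto)
  also have "measure lebesgue (ball (0::'a) \<epsilon>) powr (1 / ?d) = y * \<epsilon>"
    unfolding measure_ball_omega [OF less_imp_le [OF e]] powr_realpow [OF e, symmetric]
    using e w d by (simp add: y_def powr_mult powr_powr)
  finally have "(x + y * \<epsilon>) ^ ?d \<le> V \<beta>"
    using xy e by (simp add: x_def [symmetric] powr_realpow add_pos_pos)
  moreover have "x ^ ?d + real ?d * x ^ (?d - 1) * (y * \<epsilon>) \<le> (x + y * \<epsilon>) ^ ?d"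
    using xy e d by (intro power_ge_tangent) auto
  ultimately have 1: "real ?d * x ^ (?d - 1) * (y * \<epsilon>) \<le> F * (?w * (\<beta> ^ ?d - R ^ ?d))"
    using grow xd by linarith
  \<comment> \<open>Enlarging the shell volume on the right preserves the estimate only if
    \<open>F\<close> is nonnegative. That follows from the estimate itself, since its left-hand side
    is positive.\<close>
  have "0 < real ?d * x ^ (?d - 1) * (y * \<epsilon>)" using xy e d by simp
  then have "0 < F * (?w * (\<beta> ^ ?d - R ^ ?d))" using 1 by linarith
  moreover have "0 < ?w * (\<beta> ^ ?d - R ^ ?d)"
    using w R R0 d by (simp add: power_strict_mono)
  ultimately have F: "0 < F" by (simp add: zero_less_mult_iff)
  have "\<beta> ^ ?d + real ?d * \<beta> ^ (?d - 1) * (- \<epsilon>) \<le> (\<beta> + - \<epsilon>) ^ ?d"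
    using R R0 d by (intro power_ge_tangent) (auto simp: \<epsilon>_def)
  then have "\<beta> ^ ?d - R ^ ?d \<le> real ?d * \<beta> ^ (?d - 1) * \<epsilon>" by (simp add: \<epsilon>_def algebra_simps)
  then have "F * (?w * (\<beta> ^ ?d - R ^ ?d)) \<le> F * (?w * (real ?d * \<beta> ^ (?d - 1) * \<epsilon>))"
    using F w by (intro mult_left_mono) auto
  with 1 have "(real ?d * \<epsilon>) * (x ^ (?d - 1) * y) \<le> (real ?d * \<epsilon>) * (?w * F * \<beta> ^ (?d - 1))"
    by (simp add: mult_ac)
  then have 2: "x ^ (?d - 1) * y \<le> ?w * F * \<beta> ^ (?d - 1)"
    using e d by (simp add: mult_le_cancel_left)
  have "x ^ (?d - 1) = x powr (real ?d - 1)"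
    using xy d by (simp add: powr_realpow [symmetric] of_nat_diff Suc_leI)
  also have "\<dots> = V R powr ((real ?d - 1) / real ?d)"
    by (simp add: x_def powr_powr)
  also have "\<dots> \<ge> (real n * ?w / delta_hat TYPE('a)) powr ((real ?d - 1) / real ?d)"
    using V0 pos0 d by (intro powr_mono2) (auto simp: Suc_leI)
  finally have "(real n * ?w / delta_hat TYPE('a)) powr ((real ?d - 1) / real ?d) * y \<le> x ^ (?d - 1) * y"
    using xy by (intro mult_right_mono) auto
  with 2 show ?thesis unfolding F_def y_def by linarith
qed

theorem theorem1:
  fixes c :: "nat \<Rightarrow> 'a::euclidean_space" and n :: nat
  assumes "DIM('a) \<ge> 3"
    and "n > 1"
    and "fin_unit_ball_packing n c"
    and "locally_separable n c"
  shows "int (contact_number n c) \<le>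
    \<lfloor>real DIM('a) * real n
      - (real DIM('a) powr (- (real DIM('a) - 3) / 2)
         * delta_hat TYPE('a) powr (- (real DIM('a) - 1) / real DIM('a)))
        * real n powr ((real DIM('a) - 1) / real DIM('a))\<rfloor>"
proof -
  let ?d = "real DIM('a)" and ?w = "omega TYPE('a)" and ?\<delta> = "delta_hat TYPE('a)"
  define F where "F = real n - real (contact_number n c) / ?d"
  define K where "K = (real n * ?w / ?\<delta>) powr ((?d - 1) / ?d) * ?w powr (1 / ?d)"
  define P where "P = real n powr ((?d - 1) / ?d)"
  define Q where "Q = ?\<delta> powr (- (?d - 1) / ?d)"
  have d: "0 < ?d" by simp
  have w: "0 < ?w" by (rule omega_pos)
  have dh: "0 < ?\<delta>"
    by (rule delta_hat_bounds(1) [of "{0}" 0]) (auto simp: unit_ball_packing_def)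
  \<comment> \<open>The two exponents of \<open>?w\<close> add up to 1, so one factor
    \<open>?w\<close> splits off and later cancels.\<close>
  have K: "K = ?w * (P * Q)"
  proof -
    have "K = (real n * ?w * inverse ?\<delta>) powr ((?d - 1) / ?d) * ?w powr (1 / ?d)"
      by (simp add: K_def divide_inverse)
    also have "\<dots> = P * (?w powr ((?d - 1) / ?d) * ?w powr (1 / ?d)) * inverse ?\<delta> powr ((?d - 1) / ?d)"
      using w dh by (simp add: powr_mult P_def)
    also have "?w powr ((?d - 1) / ?d) * ?w powr (1 / ?d) = ?w"
      using w d by (simp add: powr_add [symmetric] add_divide_distrib [symmetric])
    also have "inverse ?\<delta> powr ((?d - 1) / ?d) = Q"
    proof -
      have "Q = ?\<delta> powr - ((?d - 1) / ?d)" unfolding Q_def by (simp only: minus_divide_left)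
      then show ?thesis using dh by (simp only: powr_minus inverse_powr)
    qed
    finally show ?thesis by simp
  qed
  have bound: "K \<le> ?w * F * s ^ (DIM('a) - 1)" if s: "sqrt ?d < s" for s
  proof -
    \<comment> \<open>Any \<open>R\<close> strictly between \<open>sqrt ?d\<close> and
      \<open>s\<close> would do; \<open>\<beta>\<close> is then the largest radius up to
      \<open>s\<close> that the shell condition permits.\<close>
    define R where "R = (sqrt ?d + s) / 2"
    define \<beta> where "\<beta> = min s (sqrt (R\<^sup>2 + 4 * (R - sqrt ?d) / sqrt ?d))"
    have R: "sqrt ?d < R" "R < s" using s by (auto simp: R_def)
    have R0: "0 < R" using R(1) real_sqrt_ge_zero [of ?d] by linarith
    have \<eta>: "0 < 4 * (R - sqrt ?d) / sqrt ?d" using R d by simp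
    have "R < sqrt (R\<^sup>2 + 4 * (R - sqrt ?d) / sqrt ?d)"
      using \<eta> by (intro real_less_rsqrt) simp
    then have \<beta>: "R < \<beta>" "\<beta> \<le> s" using R by (auto simp: \<beta>_def)
    have "\<beta> \<le> sqrt (R\<^sup>2 + 4 * (R - sqrt ?d) / sqrt ?d)" by (simp add: \<beta>_def)
    then have "\<beta>\<^sup>2 \<le> (sqrt (R\<^sup>2 + 4 * (R - sqrt ?d) / sqrt ?d))\<^sup>2"
      using \<beta>(1) R0 by (intro power_mono) auto
    also have "\<dots> = R\<^sup>2 + 4 * (R - sqrt ?d) / sqrt ?d"
      using \<eta> by (intro real_sqrt_pow2) (simp add: add_nonneg_pos less_imp_le)
    finally have cond: "\<beta>\<^sup>2 - R\<^sup>2 \<le> 4 * (R - sqrt ?d) / sqrt ?d" by simp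
    have le: "K \<le> ?w * F * \<beta> ^ (DIM('a) - 1)"
      unfolding K_def F_def
      by (rule isoperimetric_UN_ball [OF _ assms(3,4) R(1) \<beta>(1) cond]) (use assms(2) in simp)
    \<comment> \<open>Replacing \<open>\<beta>\<close> by \<open>s\<close> requires a nonnegative
      factor \<open>?w * F\<close>, which is read off from the positive lower bound
      \<open>K\<close>.\<close>
    have "0 < K" unfolding K_def using w dh assms(2) by simp
    then have "0 < ?w * F * \<beta> ^ (DIM('a) - 1)" using le by linarith
    moreover have "0 < \<beta> ^ (DIM('a) - 1)" using \<beta> R0 by simp
    ultimately have "0 < ?w * F" by (rule zero_less_mult_pos2)
    then have "?w * F * \<beta> ^ (DIM('a) - 1) \<le> ?w * F * s ^ (DIM('a) - 1)"
      using \<beta> R0 by (intro mult_left_mono power_mono) auto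
    with le show ?thesis by linarith
  qed
  have "K \<le> ?w * F * sqrt ?d ^ (DIM('a) - 1)"
  proof (rule tendsto_lowerbound)
    show "((\<lambda>s. ?w * F * s ^ (DIM('a) - 1)) \<longlongrightarrow> ?w * F * sqrt ?d ^ (DIM('a) - 1)) (at_right (sqrt ?d))"
      by (intro tendsto_intros)
    show "eventually (\<lambda>s. K \<le> ?w * F * s ^ (DIM('a) - 1)) (at_right (sqrt ?d))"
      using bound eventually_at_right_less [of "sqrt ?d"] by (auto elim: eventually_mono)
  qed simp
  then have "P * Q \<le> F * sqrt ?d ^ (DIM('a) - 1)"
    unfolding K using w by (simp add: mult.assoc mult_le_cancel_left_pos)
  also have "sqrt ?d ^ (DIM('a) - 1) = ?d powr ((?d - 1) / 2)"
    using d by (simp add: powr_half_sqrt [symmetric] powr_powr of_nat_diff Suc_leI flip: powr_realpow)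
  \<comment> \<open>The multiplier is chosen so that the total power of \<open>?d\<close> beside
    \<open>F\<close> is 1, turning \<open>F\<close> into \<open>?d * n - c\<close>.\<close>
  finally have "?d powr (- (?d - 3) / 2) * (P * Q) \<le> ?d powr (- (?d - 3) / 2) * (F * ?d powr ((?d - 1) / 2))"
    by (intro mult_left_mono) auto
  also have "\<dots> = F * (?d powr (- (?d - 3) / 2 + (?d - 1) / 2))"
    by (simp add: powr_add)
  also have "- (?d - 3) / 2 + (?d - 1) / 2 = 1" by (simp add: field_simps)
  also have "F * ?d powr 1 = ?d * real n - real (contact_number n c)"
    using d by (simp add: F_def field_simps)
  finally have "real (contact_number n c) \<le> ?d * real n - ?d powr (- (?d - 3) / 2) * Q * P"
    by (simp add: mult_ac)
  then show ?thesis
    unfolding P_def Q_def le_floor_iff by simp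
qed

end
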